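(* Let $N\ge 1$ be given in advance and let $\epsilon>0$ be such that $1/\epsilon$ is an integer and a power of $2$. For the fully dynamic unweighted maximum independent set of intervals problem (intervals contained in $[0,N]$ with length at least $1$), there are fully dynamic algorithms that maintain $(1+\epsilon)$-approximate solutions (i) deterministically, with worst-case update time $(1/\epsilon)^{O(1/\epsilon)}\left(\frac{1}{\epsilon}\log n\log N\right)^{2}$; and (ii) with high probability, with worst-case update time $O\left(\frac{1}{\epsilon^{2}}\log^{3}N\log^{2}n\right)$.
   Context: Input objects are open intervals $C_i=(x_i,y_i)$ with real (not necessarily integer) endpoints in $[0,N]$ and $y_i-x_i\ge 1$; all weights equal $1$. A set of intervals is independent if its members are pairwise disjoint. The maximum independent set problem asks for an independent subset of the current set $\mathcal{C}$ of maximum cardinality; $\mathrm{OPT}$ denotes an optimal solution. An independent set $I\subseteq\mathcal{C}$ is $\alpha$-approximate if $|\mathrm{OPT}|\le\alpha|I|$. Fully dynamic model: the set $\mathcal{C}$ is initially empty and each update inserts one interval into or deletes one interval from $\mathcal{C}$; $n$ is the number of intervals in $\mathcal{C}$. The algorithm maintains an (implicitly stored) approximate solution after every update; on request it can output this solution $I$ in time $O_{\epsilon}(|I|\cdot\mathrm{poly}(\log n,\log N))$, where $O_{\epsilon}$ hides factors depending only on $\epsilon$. Time is counted in elementary unit-cost operations on coordinates and pointers. "With high probability" means with probability at least $1-(1/N)^{O(1)}$. Constants hidden in $O(\cdot)$ are absolute, and logarithmic factors in running-time bounds are read as being at least $1$. *)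

theory Defs
  imports "HOL-Probability.Probability"
begin

section \<open>Independent sets of intervals\<close>

text \<open>The pair \<open>(x, y)\<close> stands for the open interval from \<open>x\<close> to \<open>y\<close>.\<close>

type_synonym interval = "real \<times> real"

definition span :: "interval \<Rightarrow> real set" where
  "span C = {fst C <..< snd C}"

definition admissible :: "real \<Rightarrow> interval \<Rightarrow> bool" where
  "admissible N C \<longleftrightarrow> 0 \<le> fst C \<and> snd C \<le> N \<and> snd C - fst C \<ge> 1"

definition independent_intervals :: "interval set \<Rightarrow> bool" where
  "independent_intervals I \<longleftrightarrow> pairwise (\<lambda>C D. disjnt (span C) (span D)) I"

definition opt_size :: "interval set \<Rightarrow> nat" where
  "opt_size \<C> = Max (card ` {I. I \<subseteq> \<C> \<and> independent_intervals I})"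

definition approximate_solution :: "real \<Rightarrow> interval set \<Rightarrow> interval set \<Rightarrow> bool" where
  "approximate_solution \<alpha> \<C> I \<longleftrightarrow>
     I \<subseteq> \<C> \<and> independent_intervals I \<and> real (opt_size \<C>) \<le> \<alpha> * real (card I)"


section \<open>Unit-cost machine\<close>

text \<open>
  The machine is a real RAM whose programs are written as while programs. It has named registers
  and an unbounded memory, both of two sorts: natural numbers (pointers and counters) and exact
  real numbers (coordinates). Memory is addressed by natural numbers. There is no rounding and no
  other conversion from reals to natural numbers: reals influence pointers only through
  comparisons. Pointers admit only addition, truncated subtraction and comparison, so that no long
  words can be built cheaply. Real literals are natural numbers, so that a program cannot carry
  information in a constant. Every operator, memory access, literal, register access and
  command costs one unit. A random bit is read from an infinite tape, which is a parameter of the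
  execution; the state records how many bits have been consumed.
\<close>

type_synonym reg = string

datatype iexp =
    INat nat
  | IReg reg
  | ILoad iexp
  | IAdd iexp iexp
  | ISub iexp iexp

datatype rexp =
    RNat nat
  | RReg reg
  | RLoad iexp
  | RAdd rexp rexp
  | RSub rexp rexp
  | RMul rexp rexp
  | RDiv rexp rexp

datatype bexp =
    ILess iexp iexp
  | RLess rexp rexp
  | BNot bexp
  | BAnd bexp bexp

datatype com =
    Skip
  | ISet reg iexp
  | RSet reg rexp
  | IStore iexp iexp
  | RStore iexp rexp
  | Flip reg
  | Emit rexp rexp
  | Seq com com
  | Cond bexp com com
  | While bexp com

record state =
  ireg :: "reg \<Rightarrow> nat"
  rreg :: "reg \<Rightarrow> real"
  imem :: "nat \<Rightarrow> nat"
  rmem :: "nat \<Rightarrow> real"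
  coins_used :: nat
  emitted :: "interval list"

primrec ival :: "state \<Rightarrow> iexp \<Rightarrow> nat" where
  "ival s (INat n) = n"
| "ival s (IReg r) = ireg s r"
| "ival s (ILoad a) = imem s (ival s a)"
| "ival s (IAdd a b) = ival s a + ival s b"
| "ival s (ISub a b) = ival s a - ival s b"

primrec rval :: "state \<Rightarrow> rexp \<Rightarrow> real" where
  "rval s (RNat n) = real n"
| "rval s (RReg r) = rreg s r"
| "rval s (RLoad a) = rmem s (ival s a)"
| "rval s (RAdd a b) = rval s a + rval s b"
| "rval s (RSub a b) = rval s a - rval s b"
| "rval s (RMul a b) = rval s a * rval s b"
| "rval s (RDiv a b) = rval s a / rval s b"

primrec bval :: "state \<Rightarrow> bexp \<Rightarrow> bool" where
  "bval s (ILess a b) \<longleftrightarrow> ival s a < ival s b"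
| "bval s (RLess a b) \<longleftrightarrow> rval s a < rval s b"
| "bval s (BNot b) \<longleftrightarrow> \<not> bval s b"
| "bval s (BAnd b c) \<longleftrightarrow> bval s b \<and> bval s c"

primrec icost :: "iexp \<Rightarrow> nat" where
  "icost (INat n) = 1"
| "icost (IReg r) = 1"
| "icost (ILoad a) = icost a + 1"
| "icost (IAdd a b) = icost a + icost b + 1"
| "icost (ISub a b) = icost a + icost b + 1"

primrec rcost :: "rexp \<Rightarrow> nat" where
  "rcost (RNat n) = 1"
| "rcost (RReg r) = 1"
| "rcost (RLoad a) = icost a + 1"
| "rcost (RAdd a b) = rcost a + rcost b + 1"
| "rcost (RSub a b) = rcost a + rcost b + 1"
| "rcost (RMul a b) = rcost a + rcost b + 1"
| "rcost (RDiv a b) = rcost a + rcost b + 1"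

primrec bcost :: "bexp \<Rightarrow> nat" where
  "bcost (ILess a b) = icost a + icost b + 1"
| "bcost (RLess a b) = rcost a + rcost b + 1"
| "bcost (BNot b) = bcost b + 1"
| "bcost (BAnd b c) = bcost b + bcost c + 1"

text \<open>\<open>exec \<omega> c s t s'\<close>: with random tape \<open>\<omega>\<close>, the program \<open>c\<close> started in \<open>s\<close> halts after
  time \<open>t\<close> in \<open>s'\<close>.\<close>

inductive exec :: "(nat \<Rightarrow> bool) \<Rightarrow> com \<Rightarrow> state \<Rightarrow> nat \<Rightarrow> state \<Rightarrow> bool" for \<omega> where
  Skip: "exec \<omega> Skip s 1 s"
| ISet: "exec \<omega> (ISet r a) s (icost a + 1) (s\<lparr>ireg := (ireg s)(r := ival s a)\<rparr>)"
| RSet: "exec \<omega> (RSet r a) s (rcost a + 1) (s\<lparr>rreg := (rreg s)(r := rval s a)\<rparr>)"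
| IStore: "exec \<omega> (IStore p a) s (icost p + icost a + 1)
             (s\<lparr>imem := (imem s)(ival s p := ival s a)\<rparr>)"
| RStore: "exec \<omega> (RStore p a) s (icost p + rcost a + 1)
             (s\<lparr>rmem := (rmem s)(ival s p := rval s a)\<rparr>)"
| Flip: "exec \<omega> (Flip r) s 1
           (s\<lparr>ireg := (ireg s)(r := of_bool (\<omega> (coins_used s))), coins_used := coins_used s + 1\<rparr>)"
| Emit: "exec \<omega> (Emit a b) s (rcost a + rcost b + 1)
           (s\<lparr>emitted := emitted s @ [(rval s a, rval s b)]\<rparr>)"
| Seq: "exec \<omega> c s t s' \<Longrightarrow> exec \<omega> d s' u s'' \<Longrightarrow> exec \<omega> (Seq c d) s (t + u + 1) s''"
| CondTrue: "bval s b \<Longrightarrow> exec \<omega> c s t s' \<Longrightarrow> exec \<omega> (Cond b c d) s (bcost b + t + 1) s'"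
| CondFalse: "\<not> bval s b \<Longrightarrow> exec \<omega> d s t s' \<Longrightarrow> exec \<omega> (Cond b c d) s (bcost b + t + 1) s'"
| WhileFalse: "\<not> bval s b \<Longrightarrow> exec \<omega> (While b c) s (bcost b + 1) s"
| WhileTrue: "bval s b \<Longrightarrow> exec \<omega> c s t s' \<Longrightarrow> exec \<omega> (While b c) s' u s'' \<Longrightarrow>
                exec \<omega> (While b c) s (bcost b + t + u + 1) s''"

inductive_cases SkipE: "exec \<omega> Skip s t s'"
  and ISetE: "exec \<omega> (ISet r a) s t s'"
  and RSetE: "exec \<omega> (RSet r a) s t s'"
  and IStoreE: "exec \<omega> (IStore p a) s t s'"
  and RStoreE: "exec \<omega> (RStore p q) s t s'"
  and FlipE: "exec \<omega> (Flip r) s t s'"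
  and EmitE: "exec \<omega> (Emit p q) s t s'"
  and SeqE: "exec \<omega> (Seq c d) s t s'"
  and CondE: "exec \<omega> (Cond b c d) s t s'"
  and WhileE: "exec \<omega> (While b c) s t s'"

lemma exec_deterministic:
  "exec \<omega> c s t s' \<Longrightarrow> exec \<omega> c s u s'' \<Longrightarrow> u = t \<and> s'' = s'"
proof (induction arbitrary: u s'' rule: exec.induct)
  case (Seq c s t s' d u' sa)
  from Seq.prems obtain t1 s1 t2 where
    *: "exec \<omega> c s t1 s1" "exec \<omega> d s1 t2 s''" "u = Suc (t1 + t2)"
    by (rule SeqE) simp
  from Seq.IH(1)[OF *(1)] Seq.IH(2) * show ?case by simp
next
  case (CondTrue s b c t s' d)
  from CondTrue.prems CondTrue.hyps obtain t1 where
    *: "exec \<omega> c s t1 s''" "u = Suc (bcost b + t1)"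
    by (elim CondE) simp_all
  from CondTrue.IH[OF *(1)] * show ?case by simp
next
  case (CondFalse s b d t s' c)
  from CondFalse.prems CondFalse.hyps obtain t1 where
    *: "exec \<omega> d s t1 s''" "u = Suc (bcost b + t1)"
    by (elim CondE) simp_all
  from CondFalse.IH[OF *(1)] * show ?case by simp
next
  case (WhileFalse s b c)
  from WhileFalse.prems show ?case
    by (rule WhileE) (use WhileFalse.hyps in simp_all)
next
  case (WhileTrue s b c t s' u' sa)
  from WhileTrue.prems obtain t1 s1 t2 where
    *: "exec \<omega> c s t1 s1" "exec \<omega> (While b c) s1 t2 s''" "u = Suc (bcost b + t1 + t2)"
    by (rule WhileE) (use WhileTrue.hyps(1) in simp_all)
  from WhileTrue.IH(1)[OF *(1)] WhileTrue.IH(2) * show ?case by simp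
qed (erule SkipE ISetE RSetE IStoreE RStoreE FlipE EmitE; simp)+

primrec coin_free :: "com \<Rightarrow> bool" where
  "coin_free Skip = True"
| "coin_free (ISet r a) = True"
| "coin_free (RSet r a) = True"
| "coin_free (IStore p a) = True"
| "coin_free (RStore p a) = True"
| "coin_free (Flip r) = False"
| "coin_free (Emit a b) = True"
| "coin_free (Seq c d) = (coin_free c \<and> coin_free d)"
| "coin_free (Cond b c d) = (coin_free c \<and> coin_free d)"
| "coin_free (While b c) = coin_free c"

definition coin_tape :: "(nat \<Rightarrow> bool) measure" where
  "coin_tape = Pi\<^sub>M UNIV (\<lambda>_. measure_pmf (bernoulli_pmf (1 / 2)))"


section \<open>Fully dynamic algorithms\<close>

datatype operation = Insert interval | Delete interval | Request

primrec apply_operation :: "operation \<Rightarrow> interval set \<Rightarrow> interval set" where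
  "apply_operation (Insert C) \<C> = insert C \<C>"
| "apply_operation (Delete C) \<C> = \<C> - {C}"
| "apply_operation Request \<C> = \<C>"

definition current :: "operation list \<Rightarrow> interval set" where
  "current ops = fold apply_operation ops {}"

primrec legal :: "real \<Rightarrow> interval set \<Rightarrow> operation \<Rightarrow> bool" where
  "legal N \<C> (Insert C) \<longleftrightarrow> admissible N C \<and> C \<notin> \<C>"
| "legal N \<C> (Delete C) \<longleftrightarrow> C \<in> \<C>"
| "legal N \<C> Request \<longleftrightarrow> True"

definition valid_ops :: "real \<Rightarrow> operation list \<Rightarrow> bool" where
  "valid_ops N ops \<longleftrightarrow> (\<forall>i < length ops. legal N (current (take i ops)) (ops ! i))"

record algorithm =
  insert_code :: com
  delete_code :: com
  request_code :: com

primrec code :: "algorithm \<Rightarrow> operation \<Rightarrow> com" where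
  "code A (Insert C) = insert_code A"
| "code A (Delete C) = delete_code A"
| "code A Request = request_code A"

text \<open>The output on a request must be determined by the memory contents; hence even
  a randomized algorithm answers requests without random bits.\<close>

definition randomized_algorithm :: "algorithm \<Rightarrow> bool" where
  "randomized_algorithm A \<longleftrightarrow> coin_free (request_code A)"

definition deterministic_algorithm :: "algorithm \<Rightarrow> bool" where
  "deterministic_algorithm A \<longleftrightarrow>
     coin_free (insert_code A) \<and> coin_free (delete_code A) \<and> coin_free (request_code A)"

text \<open>The only inputs given in advance are \<open>N\<close> and \<open>\<epsilon>\<close>; there is no free preprocessing.\<close>

definition initial_state :: "real \<Rightarrow> real \<Rightarrow> state" where
  "initial_state N \<epsilon> =
     \<lparr>ireg = (\<lambda>_. 0), rreg = (\<lambda>_. 0)(''N'' := N, ''eps'' := \<epsilon>), imem = (\<lambda>_. 0), rmem = (\<lambda>_. 0),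
      coins_used = 0, emitted = []\<rparr>"

primrec call :: "operation \<Rightarrow> state \<Rightarrow> state" where
  "call (Insert C) s = s\<lparr>rreg := (rreg s)(''x'' := fst C, ''y'' := snd C), emitted := []\<rparr>"
| "call (Delete C) s = s\<lparr>rreg := (rreg s)(''x'' := fst C, ''y'' := snd C), emitted := []\<rparr>"
| "call Request s = s\<lparr>emitted := []\<rparr>"

inductive reaches :: "algorithm \<Rightarrow> (nat \<Rightarrow> bool) \<Rightarrow> real \<Rightarrow> real \<Rightarrow> operation list \<Rightarrow> state \<Rightarrow> bool"
  for A \<omega> N \<epsilon> where
  Start: "reaches A \<omega> N \<epsilon> [] (initial_state N \<epsilon>)"
| Step: "reaches A \<omega> N \<epsilon> ops s \<Longrightarrow> exec \<omega> (code A p) (call p s) t s' \<Longrightarrow>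
           reaches A \<omega> N \<epsilon> (ops @ [p]) s'"

definition op_time :: "algorithm \<Rightarrow> (nat \<Rightarrow> bool) \<Rightarrow> real \<Rightarrow> real \<Rightarrow> operation list \<Rightarrow> operation \<Rightarrow>
    nat \<Rightarrow> bool" where
  "op_time A \<omega> N \<epsilon> ops p t \<longleftrightarrow> (\<exists>s s'. reaches A \<omega> N \<epsilon> ops s \<and> exec \<omega> (code A p) (call p s) t s')"

text \<open>\<open>answers A \<omega> N \<epsilon> ops t I\<close>: a request issued after the operations \<open>ops\<close> outputs the
  set \<open>I\<close> in time \<open>t\<close>.\<close>

definition answers :: "algorithm \<Rightarrow> (nat \<Rightarrow> bool) \<Rightarrow> real \<Rightarrow> real \<Rightarrow> operation list \<Rightarrow>
    nat \<Rightarrow> interval set \<Rightarrow> bool" where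
  "answers A \<omega> N \<epsilon> ops t I \<longleftrightarrow>
     (\<exists>s s'. reaches A \<omega> N \<epsilon> ops s \<and> exec \<omega> (request_code A) (call Request s) t s' \<and>
             distinct (emitted s') \<and> I = set (emitted s'))"

lemma reaches_deterministic:
  "reaches A \<omega> N \<epsilon> ops s \<Longrightarrow> reaches A \<omega> N \<epsilon> ops s' \<Longrightarrow> s' = s"
proof (induction arbitrary: s' rule: reaches.induct)
  case Start
  then show ?case by (cases rule: reaches.cases) simp_all
next
  case (Step ops s p t s1)
  from Step.prems obtain s0 u where
    "reaches A \<omega> N \<epsilon> ops s0" "exec \<omega> (code A p) (call p s0) u s'"
    by (cases rule: reaches.cases) simp_all
  with Step.IH[of s0] exec_deterministic[OF Step.hyps(2)] show ?case by simp
qed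

lemma answers_deterministic:
  "answers A \<omega> N \<epsilon> ops t I \<Longrightarrow> answers A \<omega> N \<epsilon> ops u J \<Longrightarrow> u = t \<and> J = I"
  unfolding answers_def by (auto dest: reaches_deterministic exec_deterministic)

text \<open>Worst-case bounds hold for every random tape. The last argument of the update bound is the
  number of intervals present after the update; the last two arguments of the request bound
  are the number of intervals present and the size of the solution that is output.\<close>

definition update_time_bound :: "algorithm \<Rightarrow> real \<Rightarrow> real \<Rightarrow> (nat \<Rightarrow> real) \<Rightarrow> bool" where
  "update_time_bound A N \<epsilon> B \<longleftrightarrow>
     (\<forall>\<omega> ops p. valid_ops N (ops @ [p]) \<and> p \<noteq> Request \<longrightarrow>
        (\<exists>t. op_time A \<omega> N \<epsilon> ops p t \<and> real t \<le> B (card (current (ops @ [p])))))"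

definition request_time_bound :: "algorithm \<Rightarrow> real \<Rightarrow> real \<Rightarrow> (nat \<Rightarrow> nat \<Rightarrow> real) \<Rightarrow> bool" where
  "request_time_bound A N \<epsilon> B \<longleftrightarrow>
     (\<forall>\<omega> ops. valid_ops N ops \<longrightarrow>
        (\<exists>t I. answers A \<omega> N \<epsilon> ops t I \<and> real t \<le> B (card (current ops)) (card I)))"

definition maintains :: "algorithm \<Rightarrow> (nat \<Rightarrow> bool) \<Rightarrow> real \<Rightarrow> real \<Rightarrow> real \<Rightarrow> operation list \<Rightarrow> bool" where
  "maintains A \<omega> N \<epsilon> \<alpha> ops \<longleftrightarrow>
     (\<exists>t I. answers A \<omega> N \<epsilon> ops t I \<and> approximate_solution \<alpha> (current ops) I)"

text \<open>Logarithmic factors are read as being at least 1.\<close>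

definition lg :: "real \<Rightarrow> real" where
  "lg z = max 1 (log 2 z)"

end

theory Submission
  imports Defs
begin

text \<open>
  Repeatedly taking, among the intervals starting at or after the end of the last chosen one, an
  interval that ends first yields a maximum independent set. Each step of this greedy rule is one
  search in a balanced tree that stores the intervals in its leaves, ordered by left endpoint, and
  in every node an interval below it that ends first. Hence an update only has to maintain the tree
  in time \<open>O(log n)\<close>, and a request computes an exact optimum in time \<open>O(log n)\<close> per interval
  output, which meets both bounds without using \<open>\<epsilon>\<close> or random bits.
\<close>


section \<open>Search trees\<close>

text \<open>The intervals that start at or after a threshold form a suffix of the leaves. One
  root-to-leaf path splits this suffix into right subtrees hanging off the path, plus possibly the
  final leaf, so comparing their stored \<open>best\<close> entries settles a greedy step. Left
  endpoints may coincide, hence the lexicographic order: it is total, so a deletion finds its leaf,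
  and it still refines the order of left endpoints.

  Two features of the machine shape the rest. Without recursion, an update becomes a descent that
  records its path and an ascent that rebuilds, and a query becomes a descent with an accumulator;
  loop invariants tie each of them to its recursive counterpart. Mutable memory would call for
  reasoning about aliasing; since nodes are copied rather than changed, facts about trees in memory
  survive all later allocations, and one only has to check that the words read lie below the fresh
  cell.

  The update bound counts the intervals after the update, while the work depends on the height
  before it; this costs a constant factor.\<close>

definition lex_less :: "interval \<Rightarrow> interval \<Rightarrow> bool" where
  "lex_less C D \<longleftrightarrow> fst C < fst D \<or> fst C = fst D \<and> snd C < snd D"

lemma lex_less_irrefl [simp]: "\<not> lex_less C C"
  by (simp add: lex_less_def)

lemma lex_less_trans: "lex_less C D \<Longrightarrow> lex_less D E \<Longrightarrow> lex_less C E"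
  by (auto simp: lex_less_def)

lemma lex_less_linear: "lex_less C D \<or> C = D \<or> lex_less D C"
  by (cases C; cases D) (auto simp: lex_less_def)

lemma lex_less_fst: "lex_less C D \<Longrightarrow> fst C \<le> fst D"
  by (auto simp: lex_less_def)

text \<open>Only nonempty sets have a tree; the empty set is represented by a null root
  pointer.\<close>

datatype itree = Tip interval | Bin itree itree

primrec leaves :: "itree \<Rightarrow> interval list" where
  "leaves (Tip C) = [C]"
| "leaves (Bin l r) = leaves l @ leaves r"

primrec ht :: "itree \<Rightarrow> nat" where
  "ht (Tip C) = 0"
| "ht (Bin l r) = Suc (max (ht l) (ht r))"

text \<open>Inner nodes carry no key of their own: the leftmost leaf of the right subtree acts as
  the separator in every descent.\<close>

primrec first :: "itree \<Rightarrow> interval" where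
  "first (Tip C) = C"
| "first (Bin l r) = first l"

primrec best :: "itree \<Rightarrow> interval" where
  "best (Tip C) = C"
| "best (Bin l r) = (if snd (best r) < snd (best l) then best r else best l)"

primrec avl :: "itree \<Rightarrow> bool" where
  "avl (Tip C) \<longleftrightarrow> True"
| "avl (Bin l r) \<longleftrightarrow> avl l \<and> avl r \<and> ht l \<le> Suc (ht r) \<and> ht r \<le> Suc (ht l)"

abbreviation ordered :: "itree \<Rightarrow> bool" where
  "ordered t \<equiv> sorted_wrt lex_less (leaves t)"

lemma first_in_leaves: "first t \<in> set (leaves t)"
  by (induction t) auto

lemma first_least: "ordered t \<Longrightarrow> D \<in> set (leaves t) \<Longrightarrow> D = first t \<or> lex_less (first t) D"
proof (induction t)
  case (Bin l r)
  then show ?case using first_in_leaves[of l] by (auto simp: sorted_wrt_append)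
qed auto

lemma best_in_leaves: "best t \<in> set (leaves t)"
  by (induction t) auto

lemma best_least: "D \<in> set (leaves t) \<Longrightarrow> snd (best t) \<le> snd D"
proof (induction t)
  case (Bin l r)
  then have "snd (best l) \<le> snd D \<or> snd (best r) \<le> snd D" by auto
  then show ?case by auto
qed simp

lemma ordered_distinct: "ordered t \<Longrightarrow> distinct (leaves t)"
  unfolding sorted_wrt_iff_nth_less distinct_conv_nth by (metis lex_less_irrefl linorder_neqE_nat)

text \<open>The square replaces the Fibonacci estimate. With \<open>a\<close> and \<open>b\<close>
  leaves below the root, the term \<open>2 * a * b\<close> of \<open>(a + b)\<^sup>2\<close> is at
  least twice the power for the smaller height, hence at least the power for the larger one, which
  the square of the taller side supplies once more. So the height is at most twice the binary
  logarithm of the number of leaves.\<close>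

lemma avl_height: "avl t \<Longrightarrow> 2 ^ ht t \<le> (length (leaves t))\<^sup>2"
proof (induction t)
  case (Bin l r)
  have *: "2 ^ Suc (max h k) \<le> (a + b)\<^sup>2"
    if "2 ^ h \<le> a\<^sup>2" "2 ^ k \<le> b\<^sup>2" "h \<le> Suc k" "k \<le> h" for a b h k :: nat
  proof -
    have "h = k \<or> h = Suc k" using that by auto
    then have h: "2 ^ h \<le> 2 * (2::nat) ^ k" by auto
    \<comment> \<open>The taller subtree need not have more leaves; both squares are bounded below
      by the smaller power, and so is the product \<open>a * b\<close>.\<close>
    have k: "2 ^ k \<le> (min a b)\<^sup>2"
      using that order_trans[OF power_increasing[of k h "2::nat"] that(1)] by (auto simp: min_def)
    have "(min a b)\<^sup>2 \<le> a * b" by (simp add: power2_eq_square mult_mono)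
    then have "2 * 2 ^ k \<le> 2 * a * b" using k by simp
    then have "2 ^ h + 2 * 2 ^ k \<le> (a + b)\<^sup>2"
      using that(1) by (simp add: power2_sum)
    moreover have "max h k = h" using that by simp
    ultimately show ?thesis using h by simp
  qed
  show ?case
  proof (cases "ht r \<le> ht l")
    case True
    then show ?thesis using *[of "ht l" "length (leaves l)" "ht r" "length (leaves r)"] Bin by simp
  next
    case False
    then show ?thesis using *[of "ht r" "length (leaves r)" "ht l" "length (leaves l)"] Bin
      by (simp add: add.commute max.commute)
  qed
qed simp

section \<open>AVL rebalancing\<close>

fun left :: "itree \<Rightarrow> itree" where
  "left (Bin l r) = l"
| "left (Tip C) = Tip C"

fun right :: "itree \<Rightarrow> itree" where
  "right (Bin l r) = r"
| "right (Tip C) = Tip C"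

text \<open>Height tests and selectors take the place of patterns because a program sees only height
  fields and child pointers. The default values of \<open>left\<close> and \<open>right\<close> on a
  \<open>Tip\<close> are never reached: each selection is guarded by a height comparison that forces
  a \<open>Bin\<close>.\<close>

definition bal :: "itree \<Rightarrow> itree \<Rightarrow> itree" where
  "bal l r =
     (if ht r + 1 < ht l then
        if ht (left l) < ht (right l)
        then Bin (Bin (left l) (left (right l))) (Bin (right (right l)) r)
        else Bin (left l) (Bin (right l) r)
      else if ht l + 1 < ht r then
        if ht (right r) < ht (left r)
        then Bin (Bin l (left (left r))) (Bin (right (left r)) (right r))
        else Bin (Bin l (left r)) (right r)
      else Bin l r)"

lemma leaves_bal [simp]: "leaves (bal l r) = leaves l @ leaves r"
proof -
  have eq: "leaves t = leaves (left t) @ leaves (right t)" if "k < ht t" for t k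
    using that by (cases t) auto
  show ?thesis by (auto simp: bal_def dest!: eq)
qed

text \<open>The lower bound on the height matters as much as the upper one: together with the exact
  value when no rotation occurs, they confine the change of height to one level, which lets
  rebalancing propagate upwards.\<close>

lemma avl_bal:
  assumes "avl l" "avl r" "ht l \<le> ht r + 2" "ht r \<le> ht l + 2"
  shows "avl (bal l r)" "ht (bal l r) \<le> Suc (max (ht l) (ht r))"
    "max (ht l) (ht r) \<le> ht (bal l r)"
    "ht l \<le> Suc (ht r) \<Longrightarrow> ht r \<le> Suc (ht l) \<Longrightarrow> ht (bal l r) = Suc (max (ht l) (ht r))"
proof -
  have "avl (bal l r) \<and> ht (bal l r) \<le> Suc (max (ht l) (ht r)) \<and> max (ht l) (ht r) \<le> ht (bal l r)
    \<and> (ht l \<le> Suc (ht r) \<longrightarrow> ht r \<le> Suc (ht l) \<longrightarrow> ht (bal l r) = Suc (max (ht l) (ht r)))"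
  proof (cases "ht r + 1 < ht l")
    case True
    then obtain ll lr where l: "l = Bin ll lr" by (cases l) auto
    show ?thesis
    proof (cases "ht ll < ht lr")
      case True
      then obtain a b where "lr = Bin a b" by (cases lr) auto
      then show ?thesis using assms l True \<open>ht r + 1 < ht l\<close> by (auto simp: bal_def)
    next
      case False
      then show ?thesis using assms l \<open>ht r + 1 < ht l\<close> by (auto simp: bal_def)
    qed
  next
    case nl: False
    show ?thesis
    proof (cases "ht l + 1 < ht r")
      case True
      then obtain rl rr where r: "r = Bin rl rr" by (cases r) auto
      show ?thesis
      proof (cases "ht rr < ht rl")
        case True
        then obtain a b where "rl = Bin a b" by (cases rl) auto
        then show ?thesis using assms r True \<open>ht l + 1 < ht r\<close> by (auto simp: bal_def)
      next
        case False
        then show ?thesis using assms r \<open>ht l + 1 < ht r\<close> by (auto simp: bal_def)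
      qed
    next
      case False
      then show ?thesis using assms nl by (auto simp: bal_def)
    qed
  qed
  then show "avl (bal l r)" "ht (bal l r) \<le> Suc (max (ht l) (ht r))"
    "max (ht l) (ht r) \<le> ht (bal l r)"
    "ht l \<le> Suc (ht r) \<Longrightarrow> ht r \<le> Suc (ht l) \<Longrightarrow> ht (bal l r) = Suc (max (ht l) (ht r))"
    by blast+
qed

text \<open>Symmetric on purpose: one pair of rebalancing lemmas then covers insertion, where a
  subtree may grow, and deletion, where it may shrink.\<close>

definition close_ht :: "itree \<Rightarrow> itree \<Rightarrow> bool" where
  "close_ht t u \<longleftrightarrow> ht t \<le> Suc (ht u) \<and> ht u \<le> Suc (ht t)"

text \<open>If a rotation happens, the new child has moved one level away from its sibling. The old
  height of the node is then the height of the taller side or one more, and these are also the two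
  possible heights after the rotation.\<close>

lemma avl_bal_left:
  assumes "avl (Bin l r)" "avl l'" "close_ht l' l"
  shows "avl (bal l' r) \<and> close_ht (bal l' r) (Bin l r)"
proof -
  have *: "avl l" "avl r" "ht l \<le> Suc (ht r)" "ht r \<le> Suc (ht l)" "ht l' \<le> Suc (ht l)" "ht l \<le> Suc (ht l')"
    using assms by (auto simp: close_ht_def)
  then have "ht l' \<le> ht r + 2" "ht r \<le> ht l' + 2" by linarith+
  note bal = avl_bal[OF assms(2) *(2) this]
  show ?thesis
  proof (cases "ht l' \<le> Suc (ht r) \<and> ht r \<le> Suc (ht l')")
    case True
    then have "ht (bal l' r) = Suc (max (ht l') (ht r))" using bal(4) by blast
    then show ?thesis using bal(1) * unfolding close_ht_def ht.simps by linarith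
  next
    case False
    then show ?thesis using bal(1-3) * unfolding close_ht_def ht.simps by linarith
  qed
qed

lemma avl_bal_right:
  assumes "avl (Bin l r)" "avl r'" "close_ht r' r"
  shows "avl (bal l r') \<and> close_ht (bal l r') (Bin l r)"
proof -
  have *: "avl l" "avl r" "ht l \<le> Suc (ht r)" "ht r \<le> Suc (ht l)" "ht r' \<le> Suc (ht r)" "ht r \<le> Suc (ht r')"
    using assms by (auto simp: close_ht_def)
  then have "ht l \<le> ht r' + 2" "ht r' \<le> ht l + 2" by linarith+
  note bal = avl_bal[OF *(1) assms(2) this]
  show ?thesis
  proof (cases "ht l \<le> Suc (ht r') \<and> ht r' \<le> Suc (ht l)")
    case True
    then have "ht (bal l r') = Suc (max (ht l) (ht r'))" using bal(4) by blast
    then show ?thesis using bal(1) * unfolding close_ht_def ht.simps by linarith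
  next
    case False
    then show ?thesis using bal(1-3) * unfolding close_ht_def ht.simps by linarith
  qed
qed

section \<open>Insertion and deletion\<close>

definition ins_leaf :: "interval \<Rightarrow> interval \<Rightarrow> itree" where
  "ins_leaf C D = (if lex_less C D then Bin (Tip C) (Tip D) else Bin (Tip D) (Tip C))"

primrec ins :: "interval \<Rightarrow> itree \<Rightarrow> itree" where
  "ins C (Tip D) = ins_leaf C D"
| "ins C (Bin l r) = (if lex_less C (first r) then bal (ins C l) r else bal l (ins C r))"

text \<open>\<open>None\<close> stands for a subtree that has become empty; its sibling then takes
  the place of the parent. The leaf reached is removed without being compared with \<open>C\<close>,
  so the result is meaningful when \<open>C\<close> is present.\<close>

primrec del :: "interval \<Rightarrow> itree \<Rightarrow> itree option" where
  "del C (Tip D) = None"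
| "del C (Bin l r) =
     (if lex_less C (first r)
      then case del C l of None \<Rightarrow> Some r | Some l' \<Rightarrow> Some (bal l' r)
      else case del C r of None \<Rightarrow> Some l | Some r' \<Rightarrow> Some (bal l r'))"

lemma avl_ins: "avl t \<Longrightarrow> avl (ins C t) \<and> close_ht (ins C t) t"
proof (induction t)
  case (Tip D)
  then show ?case by (auto simp: close_ht_def ins_leaf_def)
next
  case (Bin l r)
  then show ?case
    using avl_bal_left[of l r "ins C l"] avl_bal_right[of l r "ins C r"] by auto
qed

lemma del_None: "del C t = None \<longleftrightarrow> ht t = 0"
  by (cases t) (auto split: option.splits)

lemma avl_del: "avl t \<Longrightarrow> del C t = Some u \<Longrightarrow> avl u \<and> close_ht u t"
proof (induction t arbitrary: u)
  case (Bin l r)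
  have a: "avl l" "avl r" using Bin.prems by auto
  show ?case
  proof (cases "lex_less C (first r)")
    case True
    show ?thesis
    proof (cases "del C l")
      case None
      then have "ht l = 0" "u = r" using True Bin.prems del_None[of C l] by simp_all
      then show ?thesis using Bin.prems by (auto simp: close_ht_def)
    next
      case (Some l')
      then have "u = bal l' r" using True Bin.prems by simp
      then show ?thesis using avl_bal_left[OF Bin.prems(1)] Bin.IH(1)[OF a(1) Some] by blast
    qed
  next
    case False
    show ?thesis
    proof (cases "del C r")
      case None
      then have "ht r = 0" "u = l" using False Bin.prems del_None[of C r] by simp_all
      then show ?thesis using Bin.prems by (auto simp: close_ht_def)
    next
      case (Some r')
      then have "u = bal l r'" using False Bin.prems by simp
      then show ?thesis using avl_bal_right[OF Bin.prems(1)] Bin.IH(2)[OF a(2) Some] by blast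
    qed
  qed
qed simp

text \<open>As \<open>first r\<close> is the least leaf of \<open>r\<close>, a comparison with it
  decides the order against all leaves of \<open>r\<close>.\<close>

lemma ordered_Bin:
  "sorted_wrt lex_less (leaves l @ leaves r) \<longleftrightarrow> ordered l \<and> ordered r \<and> (\<forall>D \<in> set (leaves l). lex_less D (first r))"
  using first_in_leaves[of r] first_least[of r] lex_less_trans
  by (simp add: sorted_wrt_append) metis

lemma set_ins: "set (leaves (ins C t)) = insert C (set (leaves t))"
proof (induction t)
  case (Tip D)
  then show ?case by (auto simp: ins_leaf_def)
qed auto

lemma ordered_ins: "ordered t \<Longrightarrow> C \<notin> set (leaves t) \<Longrightarrow> ordered (ins C t)"
proof (induction t)
  case (Tip D)
  then show ?case using lex_less_linear[of C D] by (auto simp: ins_leaf_def)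
next
  case (Bin l r)
  have *: "D = first r \<or> lex_less (first r) D" if "D \<in> set (leaves r)" for D
    using that Bin.prems(1) first_least[of r D] by (simp add: sorted_wrt_append)
  show ?case
  proof (cases "lex_less C (first r)")
    case True
    then have "lex_less C D" if "D \<in> set (leaves r)" for D
      using *[OF that] lex_less_trans by blast
    then show ?thesis using Bin True by (simp add: sorted_wrt_append set_ins)
  next
    case False
    then have "lex_less (first r) C"
      using lex_less_linear[of C "first r"] Bin first_in_leaves[of r] by auto
    then have "lex_less D C" if "D \<in> set (leaves l)" for D
      using that Bin.prems(1) by (auto simp: ordered_Bin intro: lex_less_trans)
    then show ?thesis using Bin False by (simp add: sorted_wrt_append set_ins)
  qed
qed

text \<open>By the ordering, the comparison with \<open>first r\<close> leads to the only side that
  contains \<open>C\<close>, and the filter leaves the other side alone. Presence of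
  \<open>C\<close> guarantees that the leaf finally dropped is \<open>C\<close> itself.\<close>

lemma del_leaves:
  assumes "ordered t" "C \<in> set (leaves t)" "del C t = Some u"
  shows "leaves u = filter (\<lambda>D. D \<noteq> C) (leaves t)"
  using assms
proof (induction t arbitrary: u)
  case (Bin l r)
  have *: "D = first r \<or> lex_less (first r) D" if "D \<in> set (leaves r)" for D
    using that Bin.prems(1) first_least[of r D] by (simp add: sorted_wrt_append)
  have o: "ordered l" "ordered r" using Bin.prems by (auto simp: ordered_Bin)
  have id: "filter (\<lambda>D. D \<noteq> C) xs = xs" if "C \<notin> set xs" for xs :: "interval list"
    using that by (induction xs) auto
  have single: "leaves t = [C]" if "ht t = 0" "C \<in> set (leaves t)" for t
    using that by (cases t) auto
  show ?case
  proof (cases "lex_less C (first r)")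
    case True
    then have nr: "C \<notin> set (leaves r)" using *[of C] lex_less_trans[of C "first r" C] by auto
    then have "C \<in> set (leaves l)" using Bin.prems by auto
    then show ?thesis
    proof (cases "del C l")
      case None
      then have "leaves l = [C]" using \<open>C \<in> set (leaves l)\<close> single by (simp add: del_None)
      then show ?thesis using Bin.prems(3) True None id[OF nr] by simp
    next
      case (Some l')
      then show ?thesis
        using Bin.prems(3) True id[OF nr] Bin.IH(1)[OF o(1) \<open>C \<in> set (leaves l)\<close> Some] by auto
    qed
  next
    case False
    then have nl: "C \<notin> set (leaves l)" using Bin.prems by (auto simp: ordered_Bin)
    then have "C \<in> set (leaves r)" using Bin.prems by auto
    then show ?thesis
    proof (cases "del C r")
      case None
      then have "leaves r = [C]" using \<open>C \<in> set (leaves r)\<close> single by (simp add: del_None)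
      then show ?thesis using Bin.prems(3) False None id[OF nl] by simp
    next
      case (Some r')
      then show ?thesis
        using Bin.prems(3) False id[OF nl] Bin.IH(2)[OF o(2) \<open>C \<in> set (leaves r)\<close> Some] by auto
    qed
  qed
qed simp

section \<open>Earliest end among the intervals that start at or after a threshold\<close>

fun better :: "interval option \<Rightarrow> interval \<Rightarrow> interval option" where
  "better None D = Some D"
| "better (Some E) D = (if snd D < snd E then Some D else Some E)"

text \<open>The accumulator makes this a loop with the candidate in registers. Going right discards
  \<open>l\<close>, all of which starts before \<open>q\<close>; going left absorbs
  \<open>r\<close>, all of which starts at or after \<open>q\<close>, through
  \<open>best r\<close>.\<close>

primrec earliest :: "real \<Rightarrow> itree \<Rightarrow> interval option \<Rightarrow> interval option" where
  "earliest q (Tip D) acc = (if fst D < q then acc else better acc D)"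
| "earliest q (Bin l r) acc =
     (if fst (first r) < q then earliest q r acc else earliest q l (better acc (best r)))"

text \<open>A property rather than a function, since several intervals may share the smallest right
  endpoint.\<close>

definition is_earliest :: "interval set \<Rightarrow> interval option \<Rightarrow> bool" where
  "is_earliest S e \<longleftrightarrow>
     (case e of None \<Rightarrow> S = {} | Some E \<Rightarrow> E \<in> S \<and> (\<forall>D \<in> S. snd E \<le> snd D))"

lemma is_earliest_better:
  assumes "is_earliest S acc" "is_earliest T (Some D)"
  shows "is_earliest (S \<union> T) (better acc D)"
proof (cases acc)
  case None
  then show ?thesis using assms by (simp add: is_earliest_def)
next
  case (Some E)
  then show ?thesis using assms
    unfolding is_earliest_def by (simp del: split_paired_All) (meson Un_iff le_less_linear order_trans less_imp_le)
qed

text \<open>\<open>S\<close> is the set already absorbed by the accumulator; the induction needs it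
  arbitrary because a step to the left enlarges it by the leaves of \<open>r\<close>.\<close>

lemma is_earliest_earliest:
  assumes "ordered t" "is_earliest S acc"
  shows "is_earliest (S \<union> {D \<in> set (leaves t). q \<le> fst D}) (earliest q t acc)"
  using assms
proof (induction t arbitrary: acc S)
  case (Tip D)
  show ?case
  proof (cases "fst D < q")
    case True
    then have "{E \<in> set (leaves (Tip D)). q \<le> fst E} = {}" by auto
    then show ?thesis using True Tip.prems by (simp only: earliest.simps Un_empty_right if_True)
  next
    case False
    then have "{E \<in> set (leaves (Tip D)). q \<le> fst E} = {D}" by auto
    moreover have "is_earliest {D} (Some D)" by (simp add: is_earliest_def)
    ultimately show ?thesis using False Tip is_earliest_better[of S acc "{D}" D] by simp
  qed
next
  case (Bin l r)
  have o: "ordered l" "ordered r" and lt: "\<And>D. D \<in> set (leaves l) \<Longrightarrow> lex_less D (first r)"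
    using Bin.prems by (auto simp: ordered_Bin)
  show ?case
  proof (cases "fst (first r) < q")
    case True
    then have "{D \<in> set (leaves (Bin l r)). q \<le> fst D} = {D \<in> set (leaves r). q \<le> fst D}"
      by (auto dest!: lt lex_less_fst)
    then show ?thesis using Bin.IH(2)[OF o(2) Bin.prems(2)] True by simp
  next
    case False
    then have "q \<le> fst D" if "D \<in> set (leaves r)" for D
      using first_least[OF o(2) that] by (auto dest: lex_less_fst)
    then have "{D \<in> set (leaves (Bin l r)). q \<le> fst D} =
        set (leaves r) \<union> {D \<in> set (leaves l). q \<le> fst D}"
      by auto
    moreover have "is_earliest (S \<union> set (leaves r)) (better acc (best r))"
      by (rule is_earliest_better[OF Bin.prems(2)])
        (simp add: is_earliest_def best_in_leaves best_least)
    ultimately show ?thesis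
      using Bin.IH(1)[OF o(1), of "S \<union> set (leaves r)"] False by (simp add: Un_assoc)
  qed
qed


section \<open>Greedy solutions\<close>

text \<open>A relation, because ties allow several greedy lists; the optimality argument applies to
  each of them, however the tree breaks ties.\<close>

inductive greedy :: "interval set \<Rightarrow> real \<Rightarrow> interval list \<Rightarrow> bool" for S where
  Nil: "is_earliest {D \<in> S. q \<le> fst D} None \<Longrightarrow> greedy S q []"
| Cons: "is_earliest {D \<in> S. q \<le> fst D} (Some E) \<Longrightarrow> greedy S (snd E) xs \<Longrightarrow> greedy S q (E # xs)"

text \<open>Every later choice starts at or after \<open>snd E\<close> and so misses
  \<open>span E\<close>. Positive lengths keep the threshold from moving backwards and
  \<open>E\<close> from being chosen twice.\<close>

lemma greedy_independent:
  assumes "greedy S q xs" "\<And>D. D \<in> S \<Longrightarrow> fst D < snd D"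
  shows "set xs \<subseteq> {D \<in> S. q \<le> fst D} \<and> distinct xs \<and> independent_intervals (set xs)"
  using assms
proof (induction rule: greedy.induct)
  case (Nil q)
  then show ?case by (simp add: independent_intervals_def)
next
  case (Cons q E xs)
  have E: "E \<in> S" "q \<le> fst E" "fst E < snd E"
    using Cons.hyps(1) Cons.prems by (auto simp: is_earliest_def)
  have xs: "D \<in> S" "snd E \<le> fst D" if "D \<in> set xs" for D using Cons.IH Cons.prems that by auto
  have "E \<notin> set xs" using xs[of E] E by auto
  moreover have "disjnt (span E) (span D) \<and> disjnt (span D) (span E)" if "D \<in> set xs" for D
    using xs[OF that] by (auto simp: disjnt_def span_def)
  moreover have "q \<le> fst D" if "D \<in> set xs" for D using xs[OF that] E by auto
  ultimately show ?case using Cons.IH Cons.prems E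
    by (auto simp: independent_intervals_def pairwise_insert)
qed

text \<open>Exchange argument: disjoint intervals ending at or after \<open>snd E\<close> cannot both start before
  \<open>snd E\<close>, so choosing \<open>E\<close> costs at most one member of any competing solution.\<close>

lemma greedy_optimal:
  assumes "greedy S q xs" "J \<subseteq> {D \<in> S. q \<le> fst D}" "finite J" "independent_intervals J"
  shows "card J \<le> length xs"
  using assms
proof (induction arbitrary: J rule: greedy.induct)
  case (Nil q)
  then have "J = {}" unfolding is_earliest_def option.case by blast
  then show ?case by simp
next
  case (Cons q E xs)
  define K where "K = {D \<in> J. fst D < snd E}"
  have "D = D'" if "D \<in> K" "D' \<in> K" for D D'
  proof (rule ccontr)
    assume "D \<noteq> D'"
    then have "disjnt (span D) (span D')"
      using that Cons.prems by (auto simp: K_def independent_intervals_def pairwise_def)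
    moreover have "D \<in> {D \<in> S. q \<le> fst D}" "D' \<in> {D \<in> S. q \<le> fst D}"
      using that Cons.prems by (auto simp: K_def)
    then have "snd E \<le> snd D" "snd E \<le> snd D'"
      using Cons.hyps(1) unfolding is_earliest_def option.case by blast+
    moreover have "fst D < snd E" "fst D' < snd E"
      using that by (auto simp: K_def)
    ultimately have "disjnt (span D) (span D')" "snd E \<le> snd D" "snd E \<le> snd D'"
      "fst D < snd E" "fst D' < snd E"
      by auto
    \<comment> \<open>A common point: halfway between the later of the two starts and
      \<open>snd E\<close>, which neither interval ends before.\<close>
    then have "(max (fst D) (fst D') + snd E) / 2 \<in> span D \<inter> span D'"
      by (auto simp: span_def max_def)
    then show False using \<open>disjnt (span D) (span D')\<close> by (auto simp: disjnt_def)
  qed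
  then have "card K \<le> 1"
    using Cons.prems by (auto simp: K_def intro!: card_le_Suc0_iff_eq[THEN iffD2])
  \<comment> \<open>What remains starts at or after \<open>snd E\<close>, so it competes with the
    tail \<open>xs\<close> of the greedy list.\<close>
  moreover have "card (J - K) \<le> length xs"
    using Cons.prems by (intro Cons.IH)
      (auto simp: K_def independent_intervals_def intro: pairwise_subset)
  moreover have "card J \<le> card K + card (J - K)"
    using card_Un_le[of K "J - K"] by (simp add: K_def Un_absorb1)
  ultimately show ?case by simp
qed


section \<open>Zippers\<close>

text \<open>The machine has no recursion, so a descent records its path. An entry \<open>(d, t)\<close> holds the
  sibling \<open>t\<close> of the subtree in focus, which is a left sibling iff \<open>d\<close>.\<close>

type_synonym path = "(bool \<times> itree) list"

primrec down :: "interval \<Rightarrow> itree \<Rightarrow> path \<Rightarrow> interval \<times> path" where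
  "down C (Tip D) c = (D, c)"
| "down C (Bin l r) c =
     (if lex_less C (first r) then down C l ((False, r) # c) else down C r ((True, l) # c))"

fun up :: "itree \<Rightarrow> path \<Rightarrow> itree" where
  "up t [] = t"
| "up t ((d, u) # c) = up (if d then bal u t else bal t u) c"

text \<open>The calls of \<open>bal\<close> that \<open>ins\<close> makes when its recursion returns
  are those that \<open>up\<close> makes along the recorded path. The path \<open>c\<close> is
  arbitrary since each step of the descent extends it.\<close>

lemma up_ins: "down C t c = (D, c') \<Longrightarrow> up (ins_leaf C D) c' = up (ins C t) c"
  by (induction t arbitrary: c) (auto split: if_splits)

text \<open>The newest path entry holds the sibling \<open>v\<close> of the deleted leaf, and
  \<open>v\<close> replaces their parent; hence the ascent starts from \<open>v\<close> with the
  rest of the path. The path stays unextended exactly when the tree is a single leaf.\<close>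

lemma up_del:
  "down C t c = (D, c') \<Longrightarrow>
     (case del C t of None \<Rightarrow> c' = c
      | Some u \<Rightarrow> \<exists>d v c''. c' = (d, v) # c'' \<and> up v c'' = up u c)"
proof (induction t arbitrary: c)
  case (Bin l r)
  show ?case
  proof (cases "lex_less C (first r)")
    case True
    then show ?thesis using Bin.IH(1)[of "(False, r) # c"] Bin.prems by (auto split: option.splits)
  next
    case False
    then show ?thesis using Bin.IH(2)[of "(True, l) # c"] Bin.prems by (auto split: option.splits)
  qed
qed simp


section \<open>Running programs\<close>

abbreviation seq (infixr \<open>;;\<close> 60) where "c ;; d \<equiv> Seq c d"

text \<open>Programs without loops and coins. Their effect and a cost bound are computed by
  recursion on the syntax, so such code is evaluated by simplification instead of through
  \<open>exec\<close>.\<close>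

primrec straight :: "com \<Rightarrow> bool" where
  "straight Skip = True"
| "straight (ISet r a) = True"
| "straight (RSet r a) = True"
| "straight (IStore p a) = True"
| "straight (RStore p a) = True"
| "straight (Flip r) = False"
| "straight (Emit a b) = True"
| "straight (Seq c d) = (straight c \<and> straight d)"
| "straight (Cond b c d) = (straight c \<and> straight d)"
| "straight (While b c) = False"

text \<open>\<open>eff\<close> and \<open>mc\<close> are meaningful for straight programs only; the values for \<open>Flip\<close> and
  \<open>While\<close> are dummies.\<close>

primrec eff :: "com \<Rightarrow> state \<Rightarrow> state" where
  "eff Skip s = s"
| "eff (ISet r a) s = s\<lparr>ireg := (ireg s)(r := ival s a)\<rparr>"
| "eff (RSet r a) s = s\<lparr>rreg := (rreg s)(r := rval s a)\<rparr>"
| "eff (IStore p a) s = s\<lparr>imem := (imem s)(ival s p := ival s a)\<rparr>"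
| "eff (RStore p a) s = s\<lparr>rmem := (rmem s)(ival s p := rval s a)\<rparr>"
| "eff (Flip r) s = s"
| "eff (Emit a b) s = s\<lparr>emitted := emitted s @ [(rval s a, rval s b)]\<rparr>"
| "eff (Seq c d) s = eff d (eff c s)"
| "eff (Cond b c d) s = (if bval s b then eff c s else eff d s)"
| "eff (While b c) s = s"

primrec mc :: "com \<Rightarrow> nat" where
  "mc Skip = 1"
| "mc (ISet r a) = icost a + 1"
| "mc (RSet r a) = rcost a + 1"
| "mc (IStore p a) = icost p + icost a + 1"
| "mc (RStore p a) = icost p + rcost a + 1"
| "mc (Flip r) = 0"
| "mc (Emit a b) = rcost a + rcost b + 1"
| "mc (Seq c d) = mc c + mc d + 1"
| "mc (Cond b c d) = bcost b + mc c + mc d + 1"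
| "mc (While b c) = 0"

text \<open>Total correctness with a time budget \<open>T\<close> that is fixed before the
  run.\<close>

definition runs :: "(nat \<Rightarrow> bool) \<Rightarrow> com \<Rightarrow> state \<Rightarrow> nat \<Rightarrow> (state \<Rightarrow> bool) \<Rightarrow> bool" where
  "runs \<omega> c s T Q \<longleftrightarrow> (\<exists>t s'. exec \<omega> c s t s' \<and> t \<le> T \<and> Q s')"

lemma runs_mono: "runs \<omega> c s T Q \<Longrightarrow> T \<le> T' \<Longrightarrow> (\<And>s'. Q s' \<Longrightarrow> Q' s') \<Longrightarrow> runs \<omega> c s T' Q'"
  unfolding runs_def by (meson order_trans)

text \<open>Only an inequality for the time, because \<open>mc\<close> charges both branches of a
  conditional and thereby becomes independent of the state.\<close>

lemma straight_exec: "straight c \<Longrightarrow> \<exists>t. exec \<omega> c s t (eff c s) \<and> t \<le> mc c"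
proof (induction c arbitrary: s)
  case (Seq c d)
  then obtain t u where "exec \<omega> c s t (eff c s)" "t \<le> mc c"
    "exec \<omega> d (eff c s) u (eff d (eff c s))" "u \<le> mc d"
    by (meson straight.simps)
  then show ?case by (intro exI[of _ "t + u + 1"]) (auto intro: exec.Seq[simplified])
next
  case (Cond b c d)
  then obtain t u where "exec \<omega> c s t (eff c s)" "t \<le> mc c"
    "exec \<omega> d s u (eff d s)" "u \<le> mc d"
    by (meson straight.simps)
  then show ?case
    by (intro exI[of _ "bcost b + (if bval s b then t else u) + 1"])
      (auto intro: exec.CondTrue[simplified] exec.CondFalse[simplified])
qed (auto intro: exec.intros[simplified])

lemma runs_straight: "straight c \<Longrightarrow> Q (eff c s) \<Longrightarrow> runs \<omega> c s (mc c) Q"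
  using straight_exec unfolding runs_def by blast

lemma runs_seq:
  assumes "runs \<omega> c s T P" "\<And>s'. P s' \<Longrightarrow> runs \<omega> d s' U Q"
  shows "runs \<omega> (c ;; d) s (T + U + 1) Q"
proof -
  obtain t s' where 1: "exec \<omega> c s t s'" "t \<le> T" "P s'" using assms(1) by (auto simp: runs_def)
  obtain u s'' where 2: "exec \<omega> d s' u s''" "u \<le> U" "Q s''"
    using assms(2)[OF 1(3)] by (auto simp: runs_def)
  show ?thesis unfolding runs_def
    using exec.Seq[OF 1(1) 2(1)] 1 2 by (intro exI[of _ "t + u + 1"] exI[of _ s'']) auto
qed

lemma runs_cond:
  assumes "bval s b \<Longrightarrow> runs \<omega> c s T Q" "\<not> bval s b \<Longrightarrow> runs \<omega> d s U Q"
  shows "runs \<omega> (Cond b c d) s (bcost b + T + U + 1) Q"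
proof (cases "bval s b")
  case True
  then obtain t s' where "exec \<omega> c s t s'" "t \<le> T" "Q s'" using assms(1) by (auto simp: runs_def)
  then show ?thesis unfolding runs_def
    using exec.CondTrue[OF True] by (intro exI[of _ "bcost b + t + 1"] exI[of _ s']) auto
next
  case False
  then obtain t s' where "exec \<omega> d s t s'" "t \<le> U" "Q s'" using assms(2) by (auto simp: runs_def)
  then show ?thesis unfolding runs_def
    using exec.CondFalse[OF False] by (intro exI[of _ "bcost b + t + 1"] exI[of _ s']) auto
qed

definition lap :: "com \<Rightarrow> nat" where
  "lap c = (case c of While b d \<Rightarrow> bcost b + mc d + 1 | _ \<Rightarrow> 0)"

text \<open>The variant \<open>n\<close> is part of the invariant and bounds the rounds still to
  come; the factor \<open>Suc n\<close> also pays for the final, failing test.\<close>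

lemma runs_while:
  assumes "straight c" "I n s"
    and step: "\<And>n s. I n s \<Longrightarrow> bval s b \<Longrightarrow> \<exists>m < n. I m (eff c s)"
  shows "runs \<omega> (While b c) s (Suc n * lap (While b c)) (\<lambda>s'. \<exists>m. I m s' \<and> \<not> bval s' b)"
  using assms(2)
proof (induction n arbitrary: s rule: less_induct)
  case (less n)
  show ?case
  proof (cases "bval s b")
    case True
    obtain m where m: "m < n" "I m (eff c s)" using step[OF less.prems True] by blast
    obtain u s' where u: "exec \<omega> (While b c) (eff c s) u s'" "u \<le> Suc m * lap (While b c)"
      "\<exists>m. I m s' \<and> \<not> bval s' b"
      using less.IH[OF m] by (auto simp: runs_def)
    obtain t where t: "exec \<omega> c s t (eff c s)" "t \<le> mc c"
      using straight_exec[OF assms(1)] by blast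
    have "bcost b + t + u + 1 \<le> lap (While b c) + Suc m * lap (While b c)"
      using u(2) t(2) by (simp add: lap_def)
    also have "\<dots> = Suc (Suc m) * lap (While b c)" by simp
    also have "\<dots> \<le> Suc n * lap (While b c)" using m(1) by (intro mult_right_mono) auto
    finally show ?thesis
      unfolding runs_def using exec.WhileTrue[OF True t(1) u(1)] u(3) by blast
  next
    case False
    have "bcost b + 1 \<le> Suc n * lap (While b c)" by (simp add: lap_def)
    then show ?thesis
      unfolding runs_def using exec.WhileFalse[OF False] False less.prems by blast
  qed
qed


section \<open>Trees in memory\<close>

text \<open>Cells of four words are allocated consecutively and never overwritten, so trees may share
  subtrees and every tree that was once in memory stays there. Register \<open>F\<close> points to the last
  allocated cell; pointer \<open>0\<close> is null.\<close>

definition cell :: "state \<Rightarrow> nat \<Rightarrow> bool" where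
  "cell s p \<longleftrightarrow> 0 < p \<and> p \<le> ireg s ''F''"

text \<open>The two cached intervals fill the four real words of a cell. The height is zero exactly
  for leaves and thus doubles as the node tag.\<close>

definition header :: "state \<Rightarrow> nat \<Rightarrow> itree \<Rightarrow> bool" where
  "header s p t \<longleftrightarrow> cell s p \<and> imem s p = ht t
     \<and> rmem s p = fst (first t) \<and> rmem s (p + 1) = snd (first t)
     \<and> rmem s (p + 2) = fst (best t) \<and> rmem s (p + 3) = snd (best t)"

primrec rep :: "state \<Rightarrow> nat \<Rightarrow> itree \<Rightarrow> bool" where
  "rep s p (Tip C) \<longleftrightarrow> header s p (Tip C)"
| "rep s p (Bin l r) \<longleftrightarrow>
     header s p (Bin l r) \<and> rep s (imem s (p + 1)) l \<and> rep s (imem s (p + 2)) r"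

fun rep_path :: "state \<Rightarrow> nat \<Rightarrow> path \<Rightarrow> bool" where
  "rep_path s p [] \<longleftrightarrow> p = 0"
| "rep_path s p ((d, t) # c) \<longleftrightarrow>
     cell s p \<and> imem s p = of_bool d \<and> rep s (imem s (p + 1)) t \<and> rep_path s (imem s (p + 2)) c"

text \<open>The protected region ends at \<open>F + 4\<close> because the last cell, at
  \<open>F\<close>, spans four words. Besides \<open>F\<close>, only the pointer registers in
  \<open>X\<close> may change.\<close>

definition frame :: "reg set \<Rightarrow> state \<Rightarrow> state \<Rightarrow> bool" where
  "frame X s s' \<longleftrightarrow> ireg s ''F'' \<le> ireg s' ''F''
     \<and> (\<forall>i < ireg s ''F'' + 4. imem s' i = imem s i \<and> rmem s' i = rmem s i)
     \<and> (\<forall>r. r \<notin> X \<longrightarrow> r \<noteq> ''F'' \<longrightarrow> ireg s' r = ireg s r)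
     \<and> rreg s' = rreg s"

lemma frame_refl [simp]: "frame X s s"
  by (simp add: frame_def)

lemma frame_trans: "frame X s s' \<Longrightarrow> frame X s' s'' \<Longrightarrow> frame X s s''"
  by (auto simp: frame_def)

lemma frame_mono: "frame X s s' \<Longrightarrow> X \<subseteq> Y \<Longrightarrow> frame Y s s'"
  by (auto simp: frame_def)

lemma frame_ireg: "frame X s s' \<Longrightarrow> r \<notin> X \<Longrightarrow> r \<noteq> ''F'' \<Longrightarrow> ireg s' r = ireg s r"
  by (auto simp: frame_def)

lemma frame_rreg: "frame X s s' \<Longrightarrow> rreg s' = rreg s"
  by (auto simp: frame_def)

lemma header_frame: "frame X s s' \<Longrightarrow> header s p t \<Longrightarrow> header s' p t"
  by (auto simp: frame_def header_def cell_def)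

lemma rep_header: "rep s p t \<Longrightarrow> header s p t"
  by (cases t) auto

lemma rep_frame: "frame X s s' \<Longrightarrow> rep s p t \<Longrightarrow> rep s' p t"
proof (induction t arbitrary: p)
  case (Bin l r)
  then have "cell s p" by (auto simp: header_def)
  then have "imem s' (p + 1) = imem s (p + 1)" "imem s' (p + 2) = imem s (p + 2)"
    using Bin.prems(1) by (auto simp: frame_def cell_def)
  then show ?case using Bin header_frame by auto
qed (auto intro: header_frame)

lemma rep_path_frame: "frame X s s' \<Longrightarrow> rep_path s p c \<Longrightarrow> rep_path s' p c"
proof (induction c arbitrary: p)
  case (Cons e c)
  obtain d t where e: "e = (d, t)" by (cases e)
  then have "cell s p" using Cons.prems by auto
  then have "imem s' p = imem s p" "imem s' (p + 1) = imem s (p + 1)"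
    "imem s' (p + 2) = imem s (p + 2)" "cell s' p"
    using Cons.prems(1) by (auto simp: frame_def cell_def)
  then show ?case using Cons e by (auto intro: rep_frame)
qed simp

lemma rep_children:
  assumes "rep s p t" "0 < ht t"
  shows "rep s (imem s (p + 1)) (left t)" "rep s (imem s (p + 2)) (right t)"
  using assms by (cases t; auto)+

lemma rep_ht: "rep s p t \<Longrightarrow> imem s p = ht t"
  by (auto dest!: rep_header simp: header_def)

text \<open>The target register is written last, so \<open>d\<close> may coincide with
  \<open>a\<close> or \<open>b\<close>; the rotations reuse registers in this way.\<close>

definition mk :: "reg \<Rightarrow> reg \<Rightarrow> reg \<Rightarrow> com" where
  "mk a b d =
     ISet ''F'' (IAdd (IReg ''F'') (INat 4)) ;;
     Cond (ILess (ILoad (IReg a)) (ILoad (IReg b)))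
       (IStore (IReg ''F'') (IAdd (ILoad (IReg b)) (INat 1)))
       (IStore (IReg ''F'') (IAdd (ILoad (IReg a)) (INat 1))) ;;
     IStore (IAdd (IReg ''F'') (INat 1)) (IReg a) ;;
     IStore (IAdd (IReg ''F'') (INat 2)) (IReg b) ;;
     RStore (IReg ''F'') (RLoad (IReg a)) ;;
     RStore (IAdd (IReg ''F'') (INat 1)) (RLoad (IAdd (IReg a) (INat 1))) ;;
     Cond (RLess (RLoad (IAdd (IReg b) (INat 3))) (RLoad (IAdd (IReg a) (INat 3))))
       (RStore (IAdd (IReg ''F'') (INat 2)) (RLoad (IAdd (IReg b) (INat 2))) ;;
        RStore (IAdd (IReg ''F'') (INat 3)) (RLoad (IAdd (IReg b) (INat 3))))
       (RStore (IAdd (IReg ''F'') (INat 2)) (RLoad (IAdd (IReg a) (INat 2))) ;;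
        RStore (IAdd (IReg ''F'') (INat 3)) (RLoad (IAdd (IReg a) (INat 3)))) ;;
     ISet d (IReg ''F'')"

lemma straight_mk [simp]: "straight (mk a b d)"
  by (simp add: mk_def)

lemma eff_mk:
  assumes "rep s (ireg s a) t" "rep s (ireg s b) u" "a \<noteq> ''F''" "b \<noteq> ''F''" "d \<noteq> ''F''"
  shows "rep (eff (mk a b d) s) (ireg (eff (mk a b d) s) d) (Bin t u)"
    and "frame {d} s (eff (mk a b d) s)"
proof -
  define s' where "s' = eff (mk a b d) s"
  define f where "f = ireg s ''F'' + 4"
  have a: "header s (ireg s a) t" and b: "header s (ireg s b) u"
    using assms rep_header by auto
  \<comment> \<open>All stores go to \<open>f\<close> and above, all words of the two children lie
    below \<open>f\<close>; so no store disturbs a later load.\<close>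
  have le: "ireg s a < f" "ireg s b < f" "ireg s a + 1 < f" "ireg s b + 1 < f"
    "ireg s a + 2 < f" "ireg s b + 2 < f" "ireg s a + 3 < f" "ireg s b + 3 < f"
    using a b by (auto simp: header_def cell_def f_def)
  have f: "ireg s ''F'' + 4 = f" by (simp add: f_def)
  have frame: "frame {d} s s'"
    unfolding s'_def mk_def frame_def using assms(3-5) by (simp add: f_def)
  moreover have "ireg s' d = f" and "ireg s' ''F'' = f"
    unfolding s'_def mk_def using assms(3-5) by (simp_all add: f)
  moreover have "imem s' (f + 1) = ireg s a" "imem s' (f + 2) = ireg s b"
    unfolding s'_def mk_def using assms(3-5) by (simp_all add: f)
  moreover have "imem s' f = ht (Bin t u)"
    unfolding s'_def mk_def using le assms(3-5) a b by (simp add: f header_def)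
  moreover have "rmem s' f = fst (first (Bin t u))" "rmem s' (f + 1) = snd (first (Bin t u))"
    unfolding s'_def mk_def using le assms(3-5) a b by (simp_all add: f header_def)
  moreover have "rmem s' (f + 2) = fst (best (Bin t u))" "rmem s' (f + 3) = snd (best (Bin t u))"
    unfolding s'_def mk_def using le assms(3-5) a b by (simp_all add: f header_def)
  moreover have "cell s' f" using le \<open>ireg s' ''F'' = f\<close> by (simp add: cell_def)
  ultimately show "rep (eff (mk a b d) s) (ireg (eff (mk a b d) s) d) (Bin t u)"
    "frame {d} s (eff (mk a b d) s)"
    using rep_frame[OF frame assms(1)] rep_frame[OF frame assms(2)] by (auto simp: s'_def header_def)
qed

lemma rep_ireg_update [simp]: "g ''F'' = ireg s ''F'' \<Longrightarrow> rep (s\<lparr>ireg := g\<rparr>) p t = rep s p t"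
  by (induction t arbitrary: p) (auto simp: header_def cell_def)

lemma rep_path_ireg_update [simp]:
  "g ''F'' = ireg s ''F'' \<Longrightarrow> rep_path (s\<lparr>ireg := g\<rparr>) p c = rep_path s p c"
  by (induction s p c rule: rep_path.induct) (auto simp: cell_def)

section \<open>Rotations in memory\<close>

abbreviation field :: "reg \<Rightarrow> nat \<Rightarrow> iexp" where
  "field r k \<equiv> ILoad (IAdd (IReg r) (INat k))"

text \<open>\<open>bal\<close> always yields a \<open>Bin\<close>, so this part only prepares its
  two subtrees in \<open>A\<close> and \<open>B\<close>, and a common final \<open>mk\<close> builds
  the root. In the double rotations an inner node is loaded into a register that is overwritten by
  one of its own children only after the other child has been fetched.\<close>

definition rotate_code :: com where
  "rotate_code =
     Cond (ILess (IAdd (ILoad (IReg ''R'')) (INat 1)) (ILoad (IReg ''L'')))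
       (Cond (ILess (ILoad (field ''L'' 1)) (ILoad (field ''L'' 2)))
         (ISet ''A'' (field ''L'' 1) ;; ISet ''B'' (field ''L'' 2) ;;
          ISet ''C'' (field ''B'' 2) ;; ISet ''B'' (field ''B'' 1) ;;
          mk ''A'' ''B'' ''A'' ;; mk ''C'' ''R'' ''B'')
         (ISet ''A'' (field ''L'' 1) ;; ISet ''C'' (field ''L'' 2) ;; mk ''C'' ''R'' ''B''))
       (Cond (ILess (IAdd (ILoad (IReg ''L'')) (INat 1)) (ILoad (IReg ''R'')))
         (Cond (ILess (ILoad (field ''R'' 2)) (ILoad (field ''R'' 1)))
           (ISet ''B'' (field ''R'' 2) ;; ISet ''C'' (field ''R'' 1) ;;
            ISet ''A'' (field ''C'' 1) ;; ISet ''C'' (field ''C'' 2) ;;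
            mk ''L'' ''A'' ''A'' ;; mk ''C'' ''B'' ''B'')
           (ISet ''A'' (field ''R'' 1) ;; ISet ''B'' (field ''R'' 2) ;; mk ''L'' ''A'' ''A''))
         (ISet ''A'' (IReg ''L'') ;; ISet ''B'' (IReg ''R'')))"

definition bal_code :: com where
  "bal_code = rotate_code ;; mk ''A'' ''B'' ''T''"

lemma straight_bal_code [simp]: "straight bal_code"
  by (simp add: bal_code_def rotate_code_def)

definition temps :: "reg set" where
  "temps = {''A'', ''B'', ''C'', ''L'', ''R'', ''T''}"

lemma eff_mk':
  assumes "rep s (ireg s a) t" "rep s (ireg s b) u" "a \<noteq> ''F''" "b \<noteq> ''F''" "d \<in> temps"
  obtains s' where "eff (mk a b d) s = s'" "rep s' (ireg s' d) (Bin t u)" "frame {d} s s'"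
    "frame temps s s'" "\<And>r. r \<noteq> d \<Longrightarrow> r \<noteq> ''F'' \<Longrightarrow> ireg s' r = ireg s r"
    "\<And>p v. rep s p v \<Longrightarrow> rep s' p v"
proof -
  have d: "d \<noteq> ''F''" using assms(5) by (auto simp: temps_def)
  have "frame {d} s (eff (mk a b d) s)" by (rule eff_mk(2)[OF assms(1-4) d])
  then show thesis using eff_mk(1)[OF assms(1-4) d] assms(5) that[of "eff (mk a b d) s"]
    by (auto intro: frame_mono rep_frame frame_ireg)
qed

lemma eff_rotate_code:
  assumes l: "rep s (ireg s ''L'') l" and r: "rep s (ireg s ''R'') r"
  obtains a b where "bal l r = Bin a b"
    "rep (eff rotate_code s) (ireg (eff rotate_code s) ''A'') a"
    "rep (eff rotate_code s) (ireg (eff rotate_code s) ''B'') b"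
    "frame temps s (eff rotate_code s)"
proof -
  let ?s = "eff rotate_code s"
  have hl: "imem s (ireg s ''L'') = ht l" and hr: "imem s (ireg s ''R'') = ht r"
    using l r by (auto dest: rep_ht)
  have "\<exists>a b. bal l r = Bin a b \<and> rep ?s (ireg ?s ''A'') a \<and> rep ?s (ireg ?s ''B'') b \<and> frame temps s ?s"
  proof (cases "ht r + 1 < ht l")
    case True
    then have "0 < ht l" by simp
    note ch = rep_children[OF l this]
    note hch = ch[THEN rep_ht]
    show ?thesis
    proof (cases "ht (left l) < ht (right l)")
      case True1: True
      then have "0 < ht (right l)" by simp
      note ch' = rep_children[OF ch(2) this]
      \<comment> \<open>\<open>s1\<close> merges the pointer loads into a single register update;
        after it only \<open>mk\<close> is executed.\<close>
      define s1 where "s1 = s\<lparr>ireg := (ireg s)(''A'' := imem s (ireg s ''L'' + 1),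
        ''C'' := imem s (imem s (ireg s ''L'' + 2) + 2),
        ''B'' := imem s (imem s (ireg s ''L'' + 2) + 1))\<rparr>"
      have eff: "?s = eff (mk ''C'' ''R'' ''B'') (eff (mk ''A'' ''B'' ''A'') s1)"
        using True True1 hl hr hch by (simp add: rotate_code_def s1_def fun_upd_twist)
      have 1: "rep s1 (ireg s1 ''A'') (left l)" "rep s1 (ireg s1 ''B'') (left (right l))"
        "rep s1 (ireg s1 ''C'') (right (right l))" "rep s1 (ireg s1 ''R'') r"
        "frame temps s s1"
        using ch ch' r by (auto simp: s1_def frame_def temps_def)
      obtain s2 where 2: "eff (mk ''A'' ''B'' ''A'') s1 = s2"
        "rep s2 (ireg s2 ''A'') (Bin (left l) (left (right l)))" "frame temps s1 s2"
        "rep s2 (ireg s2 ''C'') (right (right l))" "rep s2 (ireg s2 ''R'') r"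
        by (rule eff_mk'[OF 1(1,2), of "''A''"]) (auto simp: temps_def 1)
      obtain s3 where 3: "eff (mk ''C'' ''R'' ''B'') s2 = s3"
        "rep s3 (ireg s3 ''B'') (Bin (right (right l)) r)" "frame temps s2 s3"
        "rep s3 (ireg s3 ''A'') (Bin (left l) (left (right l)))"
        by (rule eff_mk'[OF 2(4,5), of "''B''"]) (auto simp: temps_def 2 simp del: rep.simps)
      show ?thesis using eff 1 2 3 True True1 by (auto simp: bal_def intro: frame_trans simp del: rep.simps)
    next
      case False1: False
      define s1 where "s1 = s\<lparr>ireg := (ireg s)(''A'' := imem s (ireg s ''L'' + 1),
        ''C'' := imem s (ireg s ''L'' + 2))\<rparr>"
      have eff: "?s = eff (mk ''C'' ''R'' ''B'') s1"
        using True False1 hl hr hch by (simp add: rotate_code_def s1_def fun_upd_twist)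
      have 1: "rep s1 (ireg s1 ''A'') (left l)" "rep s1 (ireg s1 ''C'') (right l)"
        "rep s1 (ireg s1 ''R'') r" "frame temps s s1"
        using ch r by (auto simp: s1_def frame_def temps_def)
      obtain s2 where 2: "eff (mk ''C'' ''R'' ''B'') s1 = s2"
        "rep s2 (ireg s2 ''B'') (Bin (right l) r)" "frame temps s1 s2"
        "rep s2 (ireg s2 ''A'') (left l)"
        by (rule eff_mk'[OF 1(2,3), of "''B''"]) (auto simp: temps_def 1)
      show ?thesis using eff 1 2 True False1 by (auto simp: bal_def intro: frame_trans simp del: rep.simps)
    qed
  next
    case nl: False
    show ?thesis
    proof (cases "ht l + 1 < ht r")
      case True
      then have "0 < ht r" by simp
      note ch = rep_children[OF r this]
      note hch = ch[THEN rep_ht]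
      show ?thesis
      proof (cases "ht (right r) < ht (left r)")
        case True1: True
        then have "0 < ht (left r)" by simp
        note ch' = rep_children[OF ch(1) this]
        define s1 where "s1 = s\<lparr>ireg := (ireg s)(''B'' := imem s (ireg s ''R'' + 2),
          ''A'' := imem s (imem s (ireg s ''R'' + 1) + 1),
          ''C'' := imem s (imem s (ireg s ''R'' + 1) + 2))\<rparr>"
        have eff: "?s = eff (mk ''C'' ''B'' ''B'') (eff (mk ''L'' ''A'' ''A'') s1)"
          using nl True True1 hl hr hch by (simp add: rotate_code_def s1_def fun_upd_twist)
        have 1: "rep s1 (ireg s1 ''A'') (left (left r))" "rep s1 (ireg s1 ''C'') (right (left r))"
          "rep s1 (ireg s1 ''B'') (right r)" "rep s1 (ireg s1 ''L'') l" "frame temps s s1"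
          using ch ch' l by (auto simp: s1_def frame_def temps_def)
        obtain s2 where 2: "eff (mk ''L'' ''A'' ''A'') s1 = s2"
          "rep s2 (ireg s2 ''A'') (Bin l (left (left r)))" "frame temps s1 s2"
          "rep s2 (ireg s2 ''C'') (right (left r))" "rep s2 (ireg s2 ''B'') (right r)"
          by (rule eff_mk'[OF 1(4,1), of "''A''"]) (auto simp: temps_def 1)
        obtain s3 where 3: "eff (mk ''C'' ''B'' ''B'') s2 = s3"
          "rep s3 (ireg s3 ''B'') (Bin (right (left r)) (right r))" "frame temps s2 s3"
          "rep s3 (ireg s3 ''A'') (Bin l (left (left r)))"
          by (rule eff_mk'[OF 2(4,5), of "''B''"]) (auto simp: temps_def 2 simp del: rep.simps)
        show ?thesis using eff 1 2 3 nl True True1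
          by (auto simp: bal_def intro: frame_trans simp del: rep.simps)
      next
        case False1: False
        define s1 where "s1 = s\<lparr>ireg := (ireg s)(''A'' := imem s (ireg s ''R'' + 1),
          ''B'' := imem s (ireg s ''R'' + 2))\<rparr>"
        have eff: "?s = eff (mk ''L'' ''A'' ''A'') s1"
          using nl True False1 hl hr hch by (simp add: rotate_code_def s1_def fun_upd_twist)
        have 1: "rep s1 (ireg s1 ''A'') (left r)" "rep s1 (ireg s1 ''B'') (right r)"
          "rep s1 (ireg s1 ''L'') l" "frame temps s s1"
          using ch l by (auto simp: s1_def frame_def temps_def)
        obtain s2 where 2: "eff (mk ''L'' ''A'' ''A'') s1 = s2"
          "rep s2 (ireg s2 ''A'') (Bin l (left r))" "frame temps s1 s2"
          "rep s2 (ireg s2 ''B'') (right r)"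
          by (rule eff_mk'[OF 1(3,1), of "''A''"]) (auto simp: temps_def 1)
        show ?thesis using eff 1 2 nl True False1
          by (auto simp: bal_def intro: frame_trans simp del: rep.simps)
      qed
    next
      case False
      have "?s = s\<lparr>ireg := (ireg s)(''A'' := ireg s ''L'', ''B'' := ireg s ''R'')\<rparr>"
        using nl False hl hr by (simp add: rotate_code_def)
      then show ?thesis using nl False l r
        by (auto simp: bal_def frame_def temps_def)
    qed
  qed
  then show thesis using that by blast
qed

lemma eff_bal_code:
  assumes l: "rep s (ireg s ''L'') l" and r: "rep s (ireg s ''R'') r"
  shows "rep (eff bal_code s) (ireg (eff bal_code s) ''T'') (bal l r)"
    and "frame temps s (eff bal_code s)"
proof -
  obtain a b where 1: "bal l r = Bin a b"
    "rep (eff rotate_code s) (ireg (eff rotate_code s) ''A'') a"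
    "rep (eff rotate_code s) (ireg (eff rotate_code s) ''B'') b"
    "frame temps s (eff rotate_code s)"
    by (rule eff_rotate_code[OF assms])
  obtain s' where 2: "eff (mk ''A'' ''B'' ''T'') (eff rotate_code s) = s'"
    "rep s' (ireg s' ''T'') (Bin a b)" "frame temps (eff rotate_code s) s'"
    by (rule eff_mk'[OF 1(2,3), of "''T''"]) (auto simp: temps_def)
  show "rep (eff bal_code s) (ireg (eff bal_code s) ''T'') (bal l r)"
    using 1(1) 2 by (simp add: bal_code_def)
  show "frame temps s (eff bal_code s)"
    using 1(4) 2 by (auto simp: bal_code_def intro: frame_trans)
qed

text \<open>Smaller than \<open>scratch\<close>, so that the register \<open>new\<close>, set before
  the descent of an insertion, is known to survive it.\<close>

definition path_regs :: "reg set" where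
  "path_regs = {''R'', ''cur'', ''ctx''}"

definition scratch :: "reg set" where
  "scratch = temps \<union> {''cur'', ''ctx'', ''new''}"

lemma temps_scratch: "temps \<subseteq> scratch"
  by (auto simp: scratch_def)

section \<open>The ascent along a recorded path\<close>

definition up_body :: com where
  "up_body =
     Cond (ILess (ILoad (IReg ''ctx'')) (INat 1))
       (ISet ''L'' (IReg ''T'') ;; ISet ''R'' (field ''ctx'' 1))
       (ISet ''L'' (field ''ctx'' 1) ;; ISet ''R'' (IReg ''T'')) ;;
     ISet ''ctx'' (field ''ctx'' 2) ;; bal_code"

definition up_code :: com where
  "up_code = While (ILess (INat 0) (IReg ''ctx'')) up_body"

lemma eff_up_body:
  assumes t: "rep s (ireg s ''T'') t" and c: "rep_path s (ireg s ''ctx'') ((d, u) # c)"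
  shows "rep (eff up_body s) (ireg (eff up_body s) ''T'') (if d then bal u t else bal t u)"
    and "rep_path (eff up_body s) (ireg (eff up_body s) ''ctx'') c"
    and "frame scratch s (eff up_body s)"
proof -
  define s1 where "s1 = s\<lparr>ireg := (ireg s)
    (''L'' := (if d then imem s (ireg s ''ctx'' + 1) else ireg s ''T''),
     ''R'' := (if d then ireg s ''T'' else imem s (ireg s ''ctx'' + 1)),
     ''ctx'' := imem s (ireg s ''ctx'' + 2))\<rparr>"
  have eff: "eff up_body s = eff bal_code s1"
    using c by (simp add: up_body_def s1_def fun_upd_twist)
  have 1: "rep s1 (ireg s1 ''L'') (if d then u else t)" "rep s1 (ireg s1 ''R'') (if d then t else u)"
    "rep_path s1 (ireg s1 ''ctx'') c" "frame scratch s s1"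
    using t c by (auto simp: s1_def frame_def scratch_def temps_def)
  note 2 = eff_bal_code[OF 1(1,2)]
  show "rep (eff up_body s) (ireg (eff up_body s) ''T'') (if d then bal u t else bal t u)"
    using 2(1) eff by (auto split: if_splits)
  have "ireg (eff up_body s) ''ctx'' = ireg s1 ''ctx''"
    using frame_ireg[OF 2(2)] eff by (simp add: temps_def)
  then show "rep_path (eff up_body s) (ireg (eff up_body s) ''ctx'') c"
    using rep_path_frame[OF 2(2) 1(3)] eff by simp
  show "frame scratch s (eff up_body s)"
    using frame_trans[OF 1(4) frame_mono[OF 2(2) temps_scratch]] eff by simp
qed

text \<open>Invariant: climbing from the current focus gives the same tree as the original climb;
  the path length is the variant. The loop stops at pointer 0, which represents only the empty path
  because cells have positive addresses.\<close>

lemma runs_up_code: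
  assumes t: "rep s (ireg s ''T'') t" and c: "rep_path s (ireg s ''ctx'') c"
  shows "runs \<omega> up_code s (Suc (length c) * lap up_code)
    (\<lambda>s'. rep s' (ireg s' ''T'') (up t c) \<and> frame scratch s s')"
proof -
  let ?I = "\<lambda>n s'. \<exists>t' c'. n = length c' \<and> rep s' (ireg s' ''T'') t' \<and>
    rep_path s' (ireg s' ''ctx'') c' \<and> up t' c' = up t c \<and> frame scratch s s'"
  have "runs \<omega> up_code s (Suc (length c) * lap up_code)
      (\<lambda>s'. \<exists>m. ?I m s' \<and> \<not> bval s' (ILess (INat 0) (IReg ''ctx'')))"
    unfolding up_code_def
  proof (rule runs_while)
    show "straight up_body" by (simp add: up_body_def)
    show "?I (length c) s" using t c by auto
  next
    fix n s'
    assume "?I n s'" and b: "bval s' (ILess (INat 0) (IReg ''ctx''))"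
    then obtain t' c' where I: "n = length c'" "rep s' (ireg s' ''T'') t'"
      "rep_path s' (ireg s' ''ctx'') c'" "up t' c' = up t c" "frame scratch s s'"
      by blast
    obtain d u c'' where c': "c' = (d, u) # c''" using I(3) b by (cases c') auto
    note body = eff_up_body[OF I(2) I(3)[unfolded c']]
    show "\<exists>m<n. ?I m (eff up_body s')"
      using body(1,2) frame_trans[OF I(5) body(3)] I(1,4) c'
      by (intro exI[of _ "length c''"] conjI exI[of _ "if d then bal u t' else bal t' u"] exI[of _ c''])
        auto
  qed
  then show ?thesis
  proof (rule runs_mono[OF _ order_refl])
    fix s'
    assume "\<exists>m. ?I m s' \<and> \<not> bval s' (ILess (INat 0) (IReg ''ctx''))"
    then obtain t' c' where I: "rep s' (ireg s' ''T'') t'" "rep_path s' (ireg s' ''ctx'') c'"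
      "up t' c' = up t c" "frame scratch s s'" "ireg s' ''ctx'' = 0"
      by auto
    then have "c' = []" by (cases c') (auto simp: cell_def)
    then show "rep s' (ireg s' ''T'') (up t c) \<and> frame scratch s s'" using I by simp
  qed
qed

section \<open>The descent that records its path\<close>

definition lex_test :: "reg \<Rightarrow> bexp" where
  "lex_test r =
     BNot (BAnd (BNot (RLess (RReg ''x'') (RLoad (IReg r))))
       (BNot (BAnd (BNot (RLess (RLoad (IReg r)) (RReg ''x'')))
         (RLess (RReg ''y'') (RLoad (IAdd (IReg r) (INat 1)))))))"

definition arg :: "state \<Rightarrow> interval" where
  "arg s = (rreg s ''x'', rreg s ''y'')"

text \<open>The test writes the disjunction by De Morgan, and equality of left endpoints as failure
  of both strict comparisons.\<close>

lemma bval_lex_test: "rep s (ireg s r) t \<Longrightarrow> bval s (lex_test r) \<longleftrightarrow> lex_less (arg s) (first t)"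
  by (auto dest!: rep_header simp: header_def lex_test_def arg_def lex_less_def)

definition down_body :: com where
  "down_body =
     ISet ''R'' (field ''cur'' 2) ;; ISet ''F'' (IAdd (IReg ''F'') (INat 4)) ;;
     Cond (lex_test ''R'')
       (IStore (IReg ''F'') (INat 0) ;; IStore (IAdd (IReg ''F'') (INat 1)) (IReg ''R'') ;;
        ISet ''cur'' (field ''cur'' 1))
       (IStore (IReg ''F'') (INat 1) ;; IStore (IAdd (IReg ''F'') (INat 1)) (field ''cur'' 1) ;;
        ISet ''cur'' (IReg ''R'')) ;;
     IStore (IAdd (IReg ''F'') (INat 2)) (IReg ''ctx'') ;; ISet ''ctx'' (IReg ''F'')"

definition down_code :: com where
  "down_code = While (ILess (INat 0) (ILoad (IReg ''cur''))) down_body"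

lemma eff_down_body:
  assumes t: "rep s (ireg s ''cur'') (Bin l r)" and c: "rep_path s (ireg s ''ctx'') c"
  defines "s' \<equiv> eff down_body s"
  shows "rep s' (ireg s' ''cur'') (if lex_less (arg s) (first r) then l else r)"
    and "rep_path s' (ireg s' ''ctx'')
      ((if lex_less (arg s) (first r) then (False, r) else (True, l)) # c)"
    and "frame path_regs s s'"
proof -
  define f where "f = ireg s ''F'' + 4"
  have f: "ireg s ''F'' + 4 = f" by (simp add: f_def)
  define s1 where "s1 = s\<lparr>ireg := (ireg s)(''R'' := imem s (ireg s ''cur'' + 2), ''F'' := f)\<rparr>"
  have l: "rep s (imem s (ireg s ''cur'' + 1)) l" and r: "rep s (imem s (ireg s ''cur'' + 2)) r"
    and cur: "cell s (ireg s ''cur'')"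
    using t by (auto simp: header_def)
  \<comment> \<open>The child pointers are partly read after the path cell at \<open>f\<close> has
    been written, so they must lie below it.\<close>
  have le: "ireg s ''cur'' + 1 < f" "ireg s ''cur'' + 2 < f"
    using cur by (auto simp: cell_def f_def)
  have "frame {''R''} s s1" by (auto simp: s1_def frame_def f_def)
  then have "rep s1 (ireg s1 ''R'') r" using rep_frame[OF _ r] by (simp add: s1_def)
  then have test: "bval s1 (lex_test ''R'') \<longleftrightarrow> lex_less (arg s) (first r)"
    using bval_lex_test by (simp add: s1_def arg_def)
  have eff: "s' = eff (ISet ''ctx'' (IReg ''F'')) (eff (IStore (IAdd (IReg ''F'') (INat 2)) (IReg ''ctx''))
    (eff (Cond (lex_test ''R'')
       (IStore (IReg ''F'') (INat 0) ;; IStore (IAdd (IReg ''F'') (INat 1)) (IReg ''R'') ;;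
        ISet ''cur'' (field ''cur'' 1))
       (IStore (IReg ''F'') (INat 1) ;; IStore (IAdd (IReg ''F'') (INat 1)) (field ''cur'' 1) ;;
        ISet ''cur'' (IReg ''R''))) s1))"
    by (simp add: s'_def down_body_def s1_def f)
  have fr: "frame path_regs s s'"
    unfolding eff eff.simps test by (auto simp: s1_def frame_def f_def path_regs_def)
  then show "frame path_regs s s'" .
  have cur': "ireg s' ''cur'' = imem s (ireg s ''cur'' + (if lex_less (arg s) (first r) then 1 else 2))"
    unfolding eff eff.simps test using le by (simp add: s1_def)
  show "rep s' (ireg s' ''cur'') (if lex_less (arg s) (first r) then l else r)"
    unfolding cur' using rep_frame[OF fr l] rep_frame[OF fr r] by auto
  have ctx: "ireg s' ''ctx'' = f" "cell s' f"
    "imem s' f = of_bool (\<not> lex_less (arg s) (first r))"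
    "imem s' (f + 1) = imem s (ireg s ''cur'' + (if lex_less (arg s) (first r) then 2 else 1))"
    "imem s' (f + 2) = ireg s ''ctx''"
    unfolding eff eff.simps test using le by (simp_all add: s1_def cell_def)
  show "rep_path s' (ireg s' ''ctx'')
      ((if lex_less (arg s) (first r) then (False, r) else (True, l)) # c)"
    using ctx rep_frame[OF fr l] rep_frame[OF fr r] rep_path_frame[OF fr c] by auto
qed

text \<open>Invariant: continuing the descent from \<open>cur\<close> gives the result of the full
  descent. The inequality \<open>length c + ht u \<le> ht t\<close> bounds the recorded path and
  hence the ascent that follows.\<close>

lemma runs_down_code:
  assumes t: "rep s (ireg s ''cur'') t" and ctx: "ireg s ''ctx'' = 0"
  shows "runs \<omega> down_code s (Suc (ht t) * lap down_code)
    (\<lambda>s'. \<exists>D c. rep s' (ireg s' ''cur'') (Tip D) \<and> rep_path s' (ireg s' ''ctx'') c \<and>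
       down (arg s) t [] = (D, c) \<and> length c \<le> ht t \<and> frame path_regs s s')"
proof -
  let ?I = "\<lambda>n s'. \<exists>u c. n = ht u \<and> rep s' (ireg s' ''cur'') u \<and> rep_path s' (ireg s' ''ctx'') c \<and>
    down (arg s) u c = down (arg s) t [] \<and> length c + ht u \<le> ht t \<and> frame path_regs s s'"
  have "runs \<omega> down_code s (Suc (ht t) * lap down_code)
      (\<lambda>s'. \<exists>m. ?I m s' \<and> \<not> bval s' (ILess (INat 0) (ILoad (IReg ''cur''))))"
    unfolding down_code_def
  proof (rule runs_while)
    show "straight down_body" by (simp add: down_body_def)
    show "?I (ht t) s" using t ctx by (intro exI[of _ t] exI[of _ "[]"]) auto
  next
    fix n s'
    assume "?I n s'" and b: "bval s' (ILess (INat 0) (ILoad (IReg ''cur'')))"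
    then obtain u c where I: "n = ht u" "rep s' (ireg s' ''cur'') u"
      "rep_path s' (ireg s' ''ctx'') c" "down (arg s) u c = down (arg s) t []"
      "length c + ht u \<le> ht t" "frame path_regs s s'"
      by blast
    obtain l r where u: "u = Bin l r" using b rep_ht[OF I(2)] by (cases u) auto
    have "arg s' = arg s" using frame_rreg[OF I(6)] by (simp add: arg_def)
    note body = eff_down_body[OF I(2)[unfolded u] I(3), unfolded this]
    show "\<exists>m<n. ?I m (eff down_body s')"
    proof (cases "lex_less (arg s) (first r)")
      case True
      then show ?thesis using body(1,2) frame_trans[OF I(6) body(3)] I(1,4,5) u
        by (intro exI[of _ "ht l"] conjI exI[of _ l] exI[of _ "(False, r) # c"])
          (simp_all del: rep_path.simps)
    next
      case False
      then show ?thesis using body(1,2) frame_trans[OF I(6) body(3)] I(1,4,5) u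
        by (intro exI[of _ "ht r"] conjI exI[of _ r] exI[of _ "(True, l) # c"])
          (simp_all del: rep_path.simps)
    qed
  qed
  then show ?thesis
  proof (rule runs_mono[OF _ order_refl])
    fix s'
    assume "\<exists>m. ?I m s' \<and> \<not> bval s' (ILess (INat 0) (ILoad (IReg ''cur'')))"
    then obtain u c where I: "rep s' (ireg s' ''cur'') u"
      "rep_path s' (ireg s' ''ctx'') c" "down (arg s) u c = down (arg s) t []"
      "length c + ht u \<le> ht t" "frame path_regs s s'" "imem s' (ireg s' ''cur'') = 0"
      by auto
    obtain D where "u = Tip D" using rep_ht[OF I(1)] I(6) by (cases u) auto
    then show "\<exists>D c. rep s' (ireg s' ''cur'') (Tip D) \<and> rep_path s' (ireg s' ''ctx'') c \<and>
       down (arg s) t [] = (D, c) \<and> length c \<le> ht t \<and> frame path_regs s s'"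
      using I by (intro exI[of _ D] exI[of _ c]) auto
  qed
qed


section \<open>Updates\<close>

definition alloc_leaf :: com where
  "alloc_leaf =
     ISet ''F'' (IAdd (IReg ''F'') (INat 4)) ;; IStore (IReg ''F'') (INat 0) ;;
     RStore (IReg ''F'') (RReg ''x'') ;; RStore (IAdd (IReg ''F'') (INat 1)) (RReg ''y'') ;;
     RStore (IAdd (IReg ''F'') (INat 2)) (RReg ''x'') ;;
     RStore (IAdd (IReg ''F'') (INat 3)) (RReg ''y'') ;; ISet ''new'' (IReg ''F'')"

definition enter_root :: com where
  "enter_root = ISet ''cur'' (IReg ''root'') ;; ISet ''ctx'' (INat 0)"

definition attach_leaf :: com where
  "attach_leaf = Cond (lex_test ''cur'') (mk ''new'' ''cur'' ''T'') (mk ''cur'' ''new'' ''T'')"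

definition insert_prog :: com where
  "insert_prog =
     alloc_leaf ;;
     Cond (ILess (INat 0) (IReg ''root''))
       (enter_root ;; down_code ;; attach_leaf ;; up_code)
       (ISet ''T'' (IReg ''new'')) ;;
     ISet ''root'' (IReg ''T'')"

definition detach_leaf :: com where
  "detach_leaf = ISet ''T'' (field ''ctx'' 1) ;; ISet ''ctx'' (field ''ctx'' 2)"

text \<open>A legal deletion finds a nonnull root, so the descent starts at once. A null
  \<open>ctx\<close> afterwards means that the root is the leaf to remove.\<close>

definition delete_prog :: com where
  "delete_prog =
     enter_root ;; down_code ;;
     Cond (ILess (INat 0) (IReg ''ctx'')) (detach_leaf ;; up_code) (ISet ''T'' (INat 0)) ;;
     ISet ''root'' (IReg ''T'')"

text \<open>\<open>h\<close> exposes the height of the stored tree: running times are stated in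
  \<open>h\<close> before it is compared with the number of intervals.\<close>

definition stores :: "state \<Rightarrow> interval set \<Rightarrow> nat \<Rightarrow> bool" where
  "stores s S h \<longleftrightarrow> (ireg s ''root'' = 0 \<and> S = {} \<and> h = 0) \<or>
     (\<exists>t. 0 < ireg s ''root'' \<and> rep s (ireg s ''root'') t \<and> avl t \<and> ordered t
       \<and> set (leaves t) = S \<and> h = ht t)"

lemma rep_pos: "rep s p t \<Longrightarrow> 0 < p"
  by (auto dest!: rep_header simp: header_def cell_def)

lemma storesI:
  "rep s (ireg s ''root'') t \<Longrightarrow> avl t \<Longrightarrow> ordered t \<Longrightarrow> stores s (set (leaves t)) (ht t)"
  using rep_pos by (auto simp: stores_def)

text \<open>Ordered leaves are distinct, so their number is \<open>card S\<close>; the value 1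
  covers the empty set.\<close>

lemma stores_height: "stores s S h \<Longrightarrow> 2 ^ h \<le> max 1 ((card S)\<^sup>2)"
  unfolding stores_def
  using avl_height ordered_distinct by (auto simp: distinct_card le_max_iff_disj)

lemma stores_finite: "stores s S h \<Longrightarrow> finite S"
  by (auto simp: stores_def)

lemma eff_alloc_leaf:
  "rep (eff alloc_leaf s) (ireg (eff alloc_leaf s) ''new'') (Tip (arg s))"
  "frame scratch s (eff alloc_leaf s)"
  by (simp_all add: alloc_leaf_def header_def cell_def arg_def frame_def scratch_def temps_def)

lemma eff_enter_root:
  "ireg (eff enter_root s) ''cur'' = ireg s ''root''" "ireg (eff enter_root s) ''ctx'' = 0"
  "ireg (eff enter_root s) ''new'' = ireg s ''new''"
  "frame scratch s (eff enter_root s)"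
  by (simp_all add: enter_root_def frame_def scratch_def temps_def)

lemma eff_attach_leaf:
  assumes "rep s (ireg s ''new'') (Tip (arg s))" "rep s (ireg s ''cur'') (Tip D)"
  shows "rep (eff attach_leaf s) (ireg (eff attach_leaf s) ''T'') (ins_leaf (arg s) D)"
    and "frame {''T''} s (eff attach_leaf s)"
  using eff_mk[OF assms, of "''T''"] eff_mk[OF assms(2,1), of "''T''"]
    bval_lex_test[OF assms(2)]
  by (simp_all add: attach_leaf_def ins_leaf_def del: rep.simps)

lemmas scratch_simps = scratch_def temps_def

text \<open>One constant for both kinds of update: it adds up the fixed costs and the cost of a
  round of either loop, and \<open>30\<close> absorbs tests, sequencing and single assignments. The
  fixed costs are then charged once per level as well, which is harmless.\<close>

definition update_rate :: nat where
  "update_rate = mc alloc_leaf + mc enter_root + lap down_code + mc attach_leaf + mc detach_leaf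
     + lap up_code + 30"

lemma runs_insert_prog:
  assumes S: "stores s S h" and new: "arg s \<notin> S"
  shows "runs \<omega> insert_prog s (Suc h * update_rate) (\<lambda>s'. \<exists>h'. stores s' (insert (arg s) S) h')"
proof -
  let ?C = "arg s"
  let ?s = "eff alloc_leaf s"
  let ?P = "\<lambda>s'. \<exists>u. rep s' (ireg s' ''T'') u \<and> avl u \<and> ordered u \<and>
    set (leaves u) = insert ?C S"
  have root: "ireg ?s ''root'' = ireg s ''root''"
    by (rule frame_ireg[OF eff_alloc_leaf(2)]) (auto simp: scratch_simps)
  have arg: "arg ?s = ?C" using frame_rreg[OF eff_alloc_leaf(2)] by (simp add: arg_def)
  have grow: "runs \<omega> (enter_root ;; down_code ;; attach_leaf ;; up_code) ?s
      (mc enter_root + (Suc h * lap down_code + (mc attach_leaf + Suc h * lap up_code + 1) + 1) + 1) ?P"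
    if nz: "ireg s ''root'' \<noteq> 0"
  proof -
    obtain t where t: "rep s (ireg s ''root'') t" "avl t" "ordered t" "set (leaves t) = S" "h = ht t"
      using S nz by (auto simp: stores_def)
    let ?s1 = "eff enter_root ?s"
    have fr1: "frame scratch s ?s1"
      using eff_alloc_leaf(2) eff_enter_root(4) by (rule frame_trans)
    have arg1: "arg ?s1 = ?C" using frame_rreg[OF fr1] by (simp add: arg_def)
    have cur: "rep ?s1 (ireg ?s1 ''cur'') t"
      using rep_frame[OF fr1 t(1)] by (simp add: eff_enter_root root)
    have leaf: "rep ?s1 (ireg ?s1 ''new'') (Tip ?C)"
      using rep_frame[OF eff_enter_root(4) eff_alloc_leaf(1)] by (simp only: eff_enter_root(3))
    show ?thesis
    proof (rule runs_seq[OF runs_straight, where P = "\<lambda>s'. s' = ?s1"])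
      show "straight enter_root" by (simp add: enter_root_def)
      show "?s1 = ?s1" ..
    next
      fix s1 assume s1: "s1 = ?s1"
      show "runs \<omega> (down_code ;; attach_leaf ;; up_code) s1
          (Suc h * lap down_code + (mc attach_leaf + Suc h * lap up_code + 1) + 1) ?P"
        unfolding s1 t(5)
      proof (rule runs_seq[OF runs_down_code[OF cur eff_enter_root(2)], unfolded arg1])
        fix s2
        assume "\<exists>D c. rep s2 (ireg s2 ''cur'') (Tip D) \<and> rep_path s2 (ireg s2 ''ctx'') c \<and>
          down ?C t [] = (D, c) \<and> length c \<le> ht t \<and> frame path_regs ?s1 s2"
        then obtain D c where 2: "rep s2 (ireg s2 ''cur'') (Tip D)" "rep_path s2 (ireg s2 ''ctx'') c"
          "down ?C t [] = (D, c)" "length c \<le> ht t" "frame path_regs ?s1 s2"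
          by blast
        have arg2: "arg s2 = ?C" using frame_rreg[OF 2(5)] arg1 by (simp add: arg_def)
        have "ireg s2 ''new'' = ireg ?s1 ''new''" by (rule frame_ireg[OF 2(5)]) (auto simp: path_regs_def)
        then have leaf2: "rep s2 (ireg s2 ''new'') (Tip (arg s2))"
          using rep_frame[OF 2(5) leaf] by (simp only: arg2)
        note at = eff_attach_leaf[OF leaf2 2(1)]
        show "runs \<omega> (attach_leaf ;; up_code) s2 (mc attach_leaf + Suc (ht t) * lap up_code + 1) ?P"
        proof (rule runs_seq[OF runs_straight, where P = "\<lambda>s'. s' = eff attach_leaf s2"])
          show "straight attach_leaf" by (simp add: attach_leaf_def)
          show "eff attach_leaf s2 = eff attach_leaf s2" ..
        next
          fix s3 assume s3: "s3 = eff attach_leaf s2"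
          have "rep_path s3 (ireg s3 ''ctx'') c"
            using rep_path_frame[OF at(2) 2(2)] frame_ireg[OF at(2), of "''ctx''"] s3 by simp
          from runs_up_code[OF at(1)[folded s3] this, of \<omega>]
          show "runs \<omega> up_code s3 (Suc (ht t) * lap up_code) ?P"
          proof (rule runs_mono)
            show "Suc (length c) * lap up_code \<le> Suc (ht t) * lap up_code"
              using 2(4) by (intro mult_right_mono) auto
          next
            fix s'
            assume "rep s' (ireg s' ''T'') (up (ins_leaf (arg s2) D) c) \<and> frame scratch s3 s'"
            moreover have "up (ins_leaf (arg s2) D) c = ins ?C t"
              using up_ins[OF 2(3)] arg2 by simp
            ultimately show "?P s'"
              using avl_ins[OF t(2), of ?C] ordered_ins[OF t(3), of ?C] new t(4) set_ins[of ?C t]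
              by (intro exI[of _ "ins ?C t"]) simp
          qed
        qed
      qed
    qed
  qed
  have first: "runs \<omega> (ISet ''T'' (IReg ''new'')) ?s (mc (ISet ''T'' (IReg ''new''))) ?P"
    if "ireg s ''root'' = 0"
  proof (rule runs_straight)
    have "S = {}" using S that by (auto simp: stores_def)
    then show "?P (eff (ISet ''T'' (IReg ''new'')) ?s)"
      using eff_alloc_leaf(1)[of s] by (intro exI[of _ "Tip ?C"]) (simp add: header_def cell_def)
  qed simp
  have "runs \<omega> insert_prog s
      (mc alloc_leaf +
        (bcost (ILess (INat 0) (IReg ''root'')) +
          (mc enter_root + (Suc h * lap down_code + (mc attach_leaf + Suc h * lap up_code + 1) + 1) + 1)
          + mc (ISet ''T'' (IReg ''new'')) + 1
          + mc (ISet ''root'' (IReg ''T'')) + 1) + 1)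
      (\<lambda>s'. \<exists>h'. stores s' (insert ?C S) h')"
    unfolding insert_prog_def
  proof (rule runs_seq[OF runs_straight, where P = "\<lambda>s'. s' = ?s"])
    show "straight alloc_leaf" by (simp add: alloc_leaf_def)
    show "?s = ?s" ..
  next
    fix s1 assume s1: "s1 = ?s"
    show "runs \<omega> (Cond (ILess (INat 0) (IReg ''root''))
       (enter_root ;; down_code ;; attach_leaf ;; up_code) (ISet ''T'' (IReg ''new'')) ;;
       ISet ''root'' (IReg ''T'')) s1
       (bcost (ILess (INat 0) (IReg ''root'')) +
          (mc enter_root + (Suc h * lap down_code + (mc attach_leaf + Suc h * lap up_code + 1) + 1) + 1)
          + mc (ISet ''T'' (IReg ''new'')) + 1
          + mc (ISet ''root'' (IReg ''T'')) + 1)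
      (\<lambda>s'. \<exists>h'. stores s' (insert ?C S) h')"
      unfolding s1
    proof (rule runs_seq[OF runs_cond])
      assume "bval ?s (ILess (INat 0) (IReg ''root''))"
      then show "runs \<omega> (enter_root ;; down_code ;; attach_leaf ;; up_code) ?s
        (mc enter_root + (Suc h * lap down_code + (mc attach_leaf + Suc h * lap up_code + 1) + 1) + 1) ?P"
        using grow root by simp
    next
      assume "\<not> bval ?s (ILess (INat 0) (IReg ''root''))"
      then show "runs \<omega> (ISet ''T'' (IReg ''new'')) ?s (mc (ISet ''T'' (IReg ''new''))) ?P"
        using first root by simp
    next
      fix s2 assume "?P s2"
      then obtain u where u: "rep s2 (ireg s2 ''T'') u" "avl u" "ordered u"
        "set (leaves u) = insert ?C S" by blast
      show "runs \<omega> (ISet ''root'' (IReg ''T'')) s2 (mc (ISet ''root'' (IReg ''T'')))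
        (\<lambda>s'. \<exists>h'. stores s' (insert ?C S) h')"
        by (rule runs_straight) (use storesI[of "eff (ISet ''root'' (IReg ''T'')) s2" u] u in auto)
    qed
  qed
  then show ?thesis
    by (rule runs_mono) (simp_all add: update_rate_def algebra_simps)
qed

lemma runs_delete_prog:
  assumes S: "stores s S h" and mem: "arg s \<in> S"
  shows "runs \<omega> delete_prog s (Suc h * update_rate) (\<lambda>s'. \<exists>h'. stores s' (S - {arg s}) h')"
proof -
  let ?C = "arg s"
  let ?s = "eff enter_root s"
  let ?P = "\<lambda>s'. (ireg s' ''T'' = 0 \<and> S - {?C} = {}) \<or>
    (\<exists>u. rep s' (ireg s' ''T'') u \<and> avl u \<and> ordered u \<and> set (leaves u) = S - {?C})"
  obtain t where t: "rep s (ireg s ''root'') t" "avl t" "ordered t" "set (leaves t) = S" "h = ht t"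
    using S mem by (auto simp: stores_def)
  have arg: "arg ?s = ?C" using frame_rreg[OF eff_enter_root(4)] by (simp add: arg_def)
  have cur: "rep ?s (ireg ?s ''cur'') t"
    using rep_frame[OF eff_enter_root(4) t(1)] by (simp add: eff_enter_root)
  have "runs \<omega> delete_prog s
      (mc enter_root + (Suc (ht t) * lap down_code +
        (bcost (ILess (INat 0) (IReg ''ctx'')) + (mc detach_leaf + Suc (ht t) * lap up_code + 1)
          + mc (ISet ''T'' (INat 0)) + 1 + mc (ISet ''root'' (IReg ''T'')) + 1) + 1) + 1)
      (\<lambda>s'. \<exists>h'. stores s' (S - {?C}) h')"
    unfolding delete_prog_def
  proof (rule runs_seq[OF runs_straight, where P = "\<lambda>s'. s' = ?s"])
    show "straight enter_root" by (simp add: enter_root_def)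
    show "?s = ?s" ..
  next
    fix s1 assume s1: "s1 = ?s"
    show "runs \<omega> (down_code ;;
        Cond (ILess (INat 0) (IReg ''ctx'')) (detach_leaf ;; up_code) (ISet ''T'' (INat 0)) ;;
        ISet ''root'' (IReg ''T'')) s1
      (Suc (ht t) * lap down_code +
        (bcost (ILess (INat 0) (IReg ''ctx'')) + (mc detach_leaf + Suc (ht t) * lap up_code + 1)
          + mc (ISet ''T'' (INat 0)) + 1 + mc (ISet ''root'' (IReg ''T'')) + 1) + 1)
      (\<lambda>s'. \<exists>h'. stores s' (S - {?C}) h')"
      unfolding s1
    proof (rule runs_seq[OF runs_down_code[OF cur eff_enter_root(2)], unfolded arg])
      fix s2
      assume "\<exists>D c. rep s2 (ireg s2 ''cur'') (Tip D) \<and> rep_path s2 (ireg s2 ''ctx'') c \<and>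
        down ?C t [] = (D, c) \<and> length c \<le> ht t \<and> frame path_regs ?s s2"
      then obtain D c where 2: "rep_path s2 (ireg s2 ''ctx'') c"
        "down ?C t [] = (D, c)" "length c \<le> ht t"
        by blast
      show "runs \<omega> (Cond (ILess (INat 0) (IReg ''ctx'')) (detach_leaf ;; up_code) (ISet ''T'' (INat 0)) ;;
          ISet ''root'' (IReg ''T'')) s2
        (bcost (ILess (INat 0) (IReg ''ctx'')) + (mc detach_leaf + Suc (ht t) * lap up_code + 1)
          + mc (ISet ''T'' (INat 0)) + 1 + mc (ISet ''root'' (IReg ''T'')) + 1)
        (\<lambda>s'. \<exists>h'. stores s' (S - {?C}) h')"
      proof (rule runs_seq[OF runs_cond, where P = ?P])
        assume nz: "bval s2 (ILess (INat 0) (IReg ''ctx''))"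
        then have "c \<noteq> []" using 2(1) by auto
        then obtain u where u: "del ?C t = Some u"
          using up_del[OF 2(2)] by (cases "del ?C t") auto
        then obtain d v c'' where c: "c = (d, v) # c''" "up v c'' = u"
          using up_del[OF 2(2)] by auto
        let ?s3 = "eff detach_leaf s2"
        have 3: "rep ?s3 (ireg ?s3 ''T'') v" "rep_path ?s3 (ireg ?s3 ''ctx'') c''"
          using 2(1) c(1) by (simp_all add: detach_leaf_def)
        show "runs \<omega> (detach_leaf ;; up_code) s2 (mc detach_leaf + Suc (ht t) * lap up_code + 1) ?P"
        proof (rule runs_seq[OF runs_straight, where P = "\<lambda>s'. s' = ?s3"])
          show "straight detach_leaf" by (simp add: detach_leaf_def)
          show "?s3 = ?s3" ..
        next
          fix s3 assume s3: "s3 = ?s3"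
          from runs_up_code[OF 3, of \<omega>]
          show "runs \<omega> up_code s3 (Suc (ht t) * lap up_code) ?P"
            unfolding s3
          proof (rule runs_mono)
            show "Suc (length c'') * lap up_code \<le> Suc (ht t) * lap up_code"
              using 2(3) c(1) by (intro mult_right_mono) auto
          next
            fix s'
            assume "rep s' (ireg s' ''T'') (up v c'') \<and> frame scratch ?s3 s'"
            moreover have lv: "leaves u = filter (\<lambda>D. D \<noteq> ?C) (leaves t)"
              using del_leaves[OF t(3) _ u] mem t(4) by simp
            then have "ordered u" using t(3) by (simp add: sorted_wrt_filter)
            moreover have "set (leaves u) = S - {?C}" using lv t(4) by auto
            ultimately show "?P s'" using avl_del[OF t(2) u] c(2) by blast
          qed
        qed
      next
        assume nz: "\<not> bval s2 (ILess (INat 0) (IReg ''ctx''))"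
        \<comment> \<open>The descent recorded nothing, so the tree is a single leaf, which must be
          the interval to delete.\<close>
        then have "c = []" using 2(1) by (cases c) (auto simp: cell_def)
        then have "del ?C t = None" using up_del[OF 2(2)] by (auto split: option.splits)
        then have "ht t = 0" by (simp only: del_None)
        then have "S - {?C} = {}" using mem t(4) by (cases t) auto
        then show "runs \<omega> (ISet ''T'' (INat 0)) s2 (mc (ISet ''T'' (INat 0))) ?P"
          by (intro runs_straight) auto
      next
        fix s4 assume P: "?P s4"
        have "\<exists>h'. stores (eff (ISet ''root'' (IReg ''T'')) s4) (S - {?C}) h'"
        proof (cases "ireg s4 ''T'' = 0 \<and> S - {?C} = {}")
          case True
          then show ?thesis by (intro exI[of _ 0]) (simp add: stores_def)
        next
          case False
          then obtain u where "rep s4 (ireg s4 ''T'') u" "avl u" "ordered u"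
            "set (leaves u) = S - {?C}"
            using P by blast
          then show ?thesis using storesI[of "eff (ISet ''root'' (IReg ''T'')) s4" u] by auto
        qed
        then show "runs \<omega> (ISet ''root'' (IReg ''T'')) s4 (mc (ISet ''root'' (IReg ''T'')))
            (\<lambda>s'. \<exists>h'. stores s' (S - {?C}) h')"
          by (intro runs_straight) simp_all
      qed
    qed
  qed
  then show ?thesis
    by (rule runs_mono) (simp_all add: update_rate_def algebra_simps t(5))
qed


section \<open>Requests\<close>

text \<open>The condition describes when the old candidate stays, since this case is a conjunction
  and the machine has no disjunction. Ties keep the old candidate, as in
  \<open>better\<close>.\<close>

definition offer :: "reg \<Rightarrow> com" where
  "offer r =
     Cond (BAnd (ILess (INat 0) (IReg ''found'')) (BNot (RLess (RLoad (IAdd (IReg r) (INat 3))) (RReg ''by''))))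
       Skip
       (ISet ''found'' (INat 1) ;; RSet ''bx'' (RLoad (IAdd (IReg r) (INat 2))) ;;
        RSet ''by'' (RLoad (IAdd (IReg r) (INat 3))))"

definition search_body :: com where
  "search_body =
     ISet ''R'' (field ''cur'' 2) ;;
     Cond (RLess (RLoad (IReg ''R'')) (RReg ''q''))
       (ISet ''cur'' (IReg ''R''))
       (offer ''R'' ;; ISet ''cur'' (field ''cur'' 1))"

definition search_code :: com where
  "search_code = While (ILess (INat 0) (ILoad (IReg ''cur''))) search_body"

definition enter_search :: com where
  "enter_search = ISet ''found'' (INat 0) ;; ISet ''cur'' (IReg ''root'')"

definition search_leaf :: com where
  "search_leaf = Cond (RLess (RLoad (IReg ''cur'')) (RReg ''q'')) Skip (offer ''cur'')"

definition find_code :: com where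
  "find_code = enter_search ;; search_code ;; search_leaf"

definition output_code :: com where
  "output_code = Emit (RReg ''bx'') (RReg ''by'') ;; RSet ''q'' (RReg ''by'')"

definition greedy_code :: com where
  "greedy_code = While (ILess (INat 0) (IReg ''found'')) (output_code ;; find_code)"

definition request_prog :: com where
  "request_prog =
     Cond (ILess (INat 0) (IReg ''root'')) (RSet ''q'' (RNat 0) ;; find_code ;; greedy_code) Skip"

definition candidate :: "state \<Rightarrow> interval option" where
  "candidate s = (if 0 < ireg s ''found'' then Some (rreg s ''bx'', rreg s ''by'') else None)"

definition same_store :: "state \<Rightarrow> state \<Rightarrow> bool" where
  "same_store s s' \<longleftrightarrow> imem s' = imem s \<and> rmem s' = rmem s \<and> ireg s' ''F'' = ireg s ''F''
     \<and> ireg s' ''root'' = ireg s ''root''"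

text \<open>A search also keeps the threshold and the output. \<open>output_code\<close> changes
  both, so across greedy steps only \<open>same_store\<close> is preserved.\<close>

definition searching :: "state \<Rightarrow> state \<Rightarrow> bool" where
  "searching s s' \<longleftrightarrow> same_store s s' \<and> rreg s' ''q'' = rreg s ''q'' \<and> emitted s' = emitted s"

lemma same_store_trans: "same_store s s' \<Longrightarrow> same_store s' s'' \<Longrightarrow> same_store s s''"
  by (simp add: same_store_def)

lemma searching_trans: "searching s s' \<Longrightarrow> searching s' s'' \<Longrightarrow> searching s s''"
  by (simp add: searching_def same_store_def)

lemma rep_same_store: "same_store s s' \<Longrightarrow> rep s' p t = rep s p t"
  by (induction t arbitrary: p) (auto simp: same_store_def header_def cell_def)

lemma stores_same_store: "same_store s s' \<Longrightarrow> stores s' S h = stores s S h"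
  by (simp add: stores_def rep_same_store) (simp add: same_store_def)

lemma update_cur [simp]:
  "candidate (s\<lparr>ireg := (ireg s)(''cur'' := p)\<rparr>) = candidate s"
  "searching s0 (s\<lparr>ireg := (ireg s)(''cur'' := p)\<rparr>) = searching s0 s"
  by (simp_all add: candidate_def searching_def same_store_def)

lemma eff_offer:
  assumes "rep s (ireg s r) t" "r \<noteq> ''found''"
  shows "candidate (eff (offer r) s) = better (candidate s) (best t)"
    and "searching s (eff (offer r) s)"
    and "ireg (eff (offer r) s) ''cur'' = ireg s ''cur''"
  using rep_header[OF assms(1)] assms(2)
  by (auto simp: offer_def candidate_def searching_def same_store_def header_def)

lemma eff_search_body:
  assumes t: "rep s (ireg s ''cur'') (Bin l r)"
  defines "s' \<equiv> eff search_body s"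
  shows "rep s' (ireg s' ''cur'') (if fst (first r) < rreg s ''q'' then r else l)"
    and "candidate s' = (if fst (first r) < rreg s ''q'' then candidate s
      else better (candidate s) (best r))"
    and "searching s s'"
proof -
  define s1 where "s1 = s\<lparr>ireg := (ireg s)(''R'' := imem s (ireg s ''cur'' + 2))\<rparr>"
  have 1: "searching s s1" "candidate s1 = candidate s" "ireg s1 ''cur'' = ireg s ''cur''"
    "rreg s1 ''q'' = rreg s ''q''"
    by (auto simp: s1_def searching_def same_store_def candidate_def)
  have l: "rep s (imem s (ireg s ''cur'' + 1)) l" and r: "rep s1 (ireg s1 ''R'') r"
    using t by (auto simp: s1_def)
  have test: "rmem s1 (ireg s1 ''R'') = fst (first r)"
    using rep_header[OF r] by (simp add: header_def)
  note o = eff_offer[OF r, simplified]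
  have eff: "s' = (if fst (first r) < rreg s ''q'' then eff (ISet ''cur'' (IReg ''R'')) s1
      else eff (ISet ''cur'' (field ''cur'' 1)) (eff (offer ''R'') s1))"
    unfolding s'_def search_body_def using test 1(4) by (simp add: s1_def)
  have "rep s' (ireg s' ''cur'') (if fst (first r) < rreg s ''q'' then r else l)
    \<and> candidate s' = (if fst (first r) < rreg s ''q'' then candidate s
      else better (candidate s) (best r))
    \<and> searching s s'"
  proof (cases "fst (first r) < rreg s ''q''")
    case True
    then show ?thesis using r 1 eff by simp
  next
    case False
    have ss: "searching s (eff (offer ''R'') s1)" using 1(1) o(2) by (rule searching_trans)
    then have "imem (eff (offer ''R'') s1) = imem s" by (simp add: searching_def same_store_def)
    moreover have "rep (eff (offer ''R'') s1) (imem s (ireg s ''cur'' + 1)) l"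
      using l ss by (simp add: rep_same_store[of s] searching_def)
    ultimately show ?thesis using False ss o 1 eff by simp
  qed
  then show "rep s' (ireg s' ''cur'') (if fst (first r) < rreg s ''q'' then r else l)"
    "candidate s' = (if fst (first r) < rreg s ''q'' then candidate s
      else better (candidate s) (best r))"
    "searching s s'"
    by blast+
qed

definition find_rate :: nat where
  "find_rate = mc enter_search + lap search_code + mc search_leaf + 2"

text \<open>Invariant: \<open>earliest\<close> applied to the current subtree and candidate equals
  the full search. The loop ends at a leaf, where \<open>search_leaf\<close> performs the last step
  of \<open>earliest\<close>.\<close>

lemma runs_find_code:
  assumes t: "rep s (ireg s ''root'') t" and ord: "ordered t"
  shows "runs \<omega> find_code s (Suc (ht t) * find_rate)
    (\<lambda>s'. searching s s' \<and> is_earliest {D \<in> set (leaves t). rreg s ''q'' \<le> fst D} (candidate s'))"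
proof -
  let ?q = "rreg s ''q''"
  let ?s = "eff enter_search s"
  let ?Q = "\<lambda>s'. searching s s' \<and> candidate s' = earliest ?q t None"
  let ?I = "\<lambda>n s'. \<exists>u. n = ht u \<and> rep s' (ireg s' ''cur'') u \<and> searching s s' \<and>
    earliest ?q u (candidate s') = earliest ?q t None"
  let ?J = "\<lambda>s'. \<exists>m. ?I m s' \<and> \<not> bval s' (ILess (INat 0) (ILoad (IReg ''cur'')))"
  have enter: "?I (ht t) ?s"
    using t by (intro exI[of _ t])
      (simp add: enter_search_def searching_def same_store_def candidate_def)
  have loop: "runs \<omega> search_code ?s (Suc (ht t) * lap search_code) ?J"
    unfolding search_code_def
  proof (rule runs_while)
    show "straight search_body" by (simp add: search_body_def offer_def)
    show "?I (ht t) ?s" by (fact enter)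
  next
    fix n s'
    assume "?I n s'" and b: "bval s' (ILess (INat 0) (ILoad (IReg ''cur'')))"
    then obtain u where I: "n = ht u" "rep s' (ireg s' ''cur'') u" "searching s s'"
      "earliest ?q u (candidate s') = earliest ?q t None"
      by blast
    obtain l r where u: "u = Bin l r" using b rep_ht[OF I(2)] by (cases u) auto
    have q: "rreg s' ''q'' = ?q" using I(3) by (simp add: searching_def)
    note body = eff_search_body[OF I(2)[unfolded u], unfolded q]
    show "\<exists>m<n. ?I m (eff search_body s')"
      using body(1,2) searching_trans[OF I(3) body(3)] I(1,4) u
      by (intro exI[of _ "ht (if fst (first r) < ?q then r else l)"] conjI
          exI[of _ "if fst (first r) < ?q then r else l"]) auto
  qed
  have "runs \<omega> find_code s
      (mc enter_search + (Suc (ht t) * lap search_code + mc search_leaf + 1) + 1) ?Q"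
    unfolding find_code_def
  proof (rule runs_seq[OF runs_straight, where P = "\<lambda>s'. s' = ?s"])
    show "straight enter_search" by (simp add: enter_search_def)
    show "?s = ?s" ..
  next
    fix s1 assume s1: "s1 = ?s"
    show "runs \<omega> (search_code ;; search_leaf) s1
      (Suc (ht t) * lap search_code + mc search_leaf + 1) ?Q"
      unfolding s1
    proof (rule runs_seq[OF loop])
      fix s' assume "?J s'"
      then obtain u where I: "rep s' (ireg s' ''cur'') u" "searching s s'"
        "earliest ?q u (candidate s') = earliest ?q t None" "imem s' (ireg s' ''cur'') = 0"
        by auto
      obtain D where u: "u = Tip D" using rep_ht[OF I(1)] I(4) by (cases u) auto
      have q: "rreg s' ''q'' = ?q" using I(2) by (simp add: searching_def)
      have x: "rmem s' (ireg s' ''cur'') = fst D" using rep_header[OF I(1)] u by (simp add: header_def)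
      note o = eff_offer[OF I(1), simplified]
      have "?Q (eff search_leaf s')"
        using o(1) searching_trans[OF I(2) o(2)] I(2,3) u q x by (simp add: search_leaf_def split: if_splits)
      then show "runs \<omega> search_leaf s' (mc search_leaf) ?Q"
        by (intro runs_straight) (simp_all add: search_leaf_def offer_def)
    qed
  qed
  moreover have "is_earliest {D \<in> set (leaves t). ?q \<le> fst D} (earliest ?q t None)"
    using is_earliest_earliest[OF ord, of "{}" None ?q] by (simp add: is_earliest_def)
  ultimately show ?thesis
    by (elim runs_mono) (simp_all add: find_rate_def algebra_simps)
qed

definition greedy_rate :: nat where
  "greedy_rate = bcost (ILess (INat 0) (IReg ''found'')) + mc output_code + find_rate + 2"

text \<open>The number of intervals that start at or after the threshold decreases, since the chosen
  one starts before its own end. The time depends on the length of the output, known only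
  afterwards, so the statement uses \<open>exec\<close> and not \<open>runs\<close>.\<close>

lemma exec_greedy_code:
  assumes S: "\<And>D. D \<in> S \<Longrightarrow> fst D < snd D"
    and t: "rep s (ireg s ''root'') t" "ordered t" "set (leaves t) = S"
    and cand: "is_earliest {D \<in> S. rreg s ''q'' \<le> fst D} (candidate s)"
  shows "\<exists>xs n s'. greedy S (rreg s ''q'') xs \<and> exec \<omega> greedy_code s n s' \<and>
    n \<le> Suc (length xs) * (Suc (ht t) * greedy_rate) \<and> emitted s' = emitted s @ xs \<and> same_store s s'"
  using t(1) cand
proof (induction "card {D \<in> S. rreg s ''q'' \<le> fst D}" arbitrary: s rule: less_induct)
  case less
  let ?b = "ILess (INat 0) (IReg ''found'')"
  have le: "bcost ?b + 1 \<le> Suc (ht t) * greedy_rate" by (simp add: greedy_rate_def)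
  show ?case
  proof (cases "candidate s")
    case None
    then have b: "\<not> bval s ?b" by (simp add: candidate_def split: if_splits)
    have "greedy S (rreg s ''q'') []" using less.prems(2) None by (auto intro: greedy.Nil)
    then show ?thesis
      using exec.WhileFalse[where c = "output_code ;; find_code", OF b] le
      unfolding greedy_code_def by (intro exI[of _ "[]"]) (auto simp: same_store_def)
  next
    case (Some E)
    then have b: "bval s ?b" and E: "E = (rreg s ''bx'', rreg s ''by'')"
      by (simp_all add: candidate_def split: if_splits)
    have SE: "E \<in> S" "rreg s ''q'' \<le> fst E" "fst E < snd E"
      using less.prems(2) Some S by (auto simp: is_earliest_def)
    let ?s1 = "eff output_code s"
    have 1: "same_store s ?s1" "rreg ?s1 ''q'' = snd E" "emitted ?s1 = emitted s @ [E]"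
      by (simp_all add: output_code_def same_store_def E)
    obtain n1 where n1: "exec \<omega> output_code s n1 ?s1" "n1 \<le> mc output_code"
      using straight_exec[of output_code \<omega> s] by (auto simp: output_code_def)
    have "rep ?s1 (ireg ?s1 ''root'') t"
      using less.prems(1) 1(1) by (simp add: rep_same_store) (simp add: same_store_def)
    from runs_find_code[OF this t(2), of \<omega>] obtain n2 s2 where
      n2: "exec \<omega> find_code ?s1 n2 s2" "n2 \<le> Suc (ht t) * find_rate" and
      s2: "searching ?s1 s2" "is_earliest {D \<in> S. snd E \<le> fst D} (candidate s2)"
      unfolding runs_def t(3) 1(2) by blast
    have st: "same_store s s2" and q2: "rreg s2 ''q'' = snd E"
      using s2(1) 1 by (auto simp: searching_def same_store_def)
    have "{D \<in> S. rreg s2 ''q'' \<le> fst D} \<subset> {D \<in> S. rreg s ''q'' \<le> fst D}"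
      using SE q2 by force
    then have "card {D \<in> S. rreg s2 ''q'' \<le> fst D} < card {D \<in> S. rreg s ''q'' \<le> fst D}"
      by (rule psubset_card_mono[rotated]) (use t(3) in auto)
    moreover have "rep s2 (ireg s2 ''root'') t"
      using less.prems(1) st by (simp add: rep_same_store) (simp add: same_store_def)
    ultimately obtain xs n3 s3 where IH: "greedy S (snd E) xs" "exec \<omega> greedy_code s2 n3 s3"
      "n3 \<le> Suc (length xs) * (Suc (ht t) * greedy_rate)" "emitted s3 = emitted s2 @ xs"
      "same_store s2 s3"
      using less.hyps[of s2] s2(2) q2 by auto
    have "exec \<omega> greedy_code s (bcost ?b + (n1 + n2 + 1) + n3 + 1) s3"
      unfolding greedy_code_def
      by (rule exec.WhileTrue[OF b exec.Seq[OF n1(1) n2(1)] IH(2)[unfolded greedy_code_def]])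
    moreover have "bcost ?b + (n1 + n2 + 1) + 1 \<le> Suc (ht t) * greedy_rate"
      using n1(2) n2(2) by (simp add: greedy_rate_def algebra_simps)
    then have "bcost ?b + (n1 + n2 + 1) + n3 + 1 \<le> Suc (length (E # xs)) * (Suc (ht t) * greedy_rate)"
      using IH(3) by simp
    moreover have "greedy S (rreg s ''q'') (E # xs)"
      using less.prems(2) Some IH(1) by (auto intro: greedy.Cons)
    moreover have "emitted s3 = emitted s @ E # xs"
      using IH(4) s2(1) 1(3) by (simp add: searching_def)
    ultimately show ?thesis using same_store_trans[OF st IH(5)] by blast
  qed
qed

definition request_rate :: nat where
  "request_rate = find_rate + greedy_rate + 20"

text \<open>The initial threshold 0 excludes nothing because all left endpoints are
  nonnegative.\<close>

lemma exec_request_prog: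
  assumes S: "\<And>D. D \<in> S \<Longrightarrow> 0 \<le> fst D \<and> fst D < snd D" and st: "stores s S h"
    and em: "emitted s = []"
  shows "\<exists>n s'. greedy S 0 (emitted s') \<and> exec \<omega> request_prog s n s' \<and>
    n \<le> Suc (length (emitted s')) * (Suc h * request_rate) \<and> stores s' S h"
proof (cases "ireg s ''root'' = 0")
  case True
  then have "S = {}" using st by (auto simp: stores_def)
  then have "greedy S 0 []" by (auto intro: greedy.Nil simp: is_earliest_def)
  moreover have "exec \<omega> request_prog s (bcost (ILess (INat 0) (IReg ''root'')) + 1 + 1) s"
    unfolding request_prog_def by (rule exec.CondFalse[OF _ exec.Skip]) (simp add: True)
  moreover have "bcost (ILess (INat 0) (IReg ''root'')) + 1 + 1 \<le> Suc (length []) * (Suc h * request_rate)"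
    by (simp add: request_rate_def)
  ultimately show ?thesis using em st by metis
next
  case False
  then obtain t where t: "rep s (ireg s ''root'') t" "avl t" "ordered t" "set (leaves t) = S" "h = ht t"
    using st by (auto simp: stores_def)
  let ?s1 = "eff (RSet ''q'' (RNat 0)) s"
  have 1: "same_store s ?s1" "rreg ?s1 ''q'' = 0" "emitted ?s1 = []"
    by (simp_all add: same_store_def em)
  have "rep ?s1 (ireg ?s1 ''root'') t"
    using t(1) 1(1) by (simp only: rep_same_store) simp
  from runs_find_code[OF this t(3), of \<omega>] obtain n2 s2 where
    n2: "exec \<omega> find_code ?s1 n2 s2" "n2 \<le> Suc h * find_rate" and
    s2: "searching ?s1 s2" "is_earliest {D \<in> S. 0 \<le> fst D} (candidate s2)"
    unfolding runs_def t(4) 1(2) t(5) by blast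
  have st2: "same_store s s2" and q2: "rreg s2 ''q'' = 0" and em2: "emitted s2 = []"
    using s2(1) 1 by (auto simp: searching_def same_store_def)
  have "rep s2 (ireg s2 ''root'') t"
    using t(1) st2 by (simp add: rep_same_store) (simp add: same_store_def)
  from exec_greedy_code[OF _ this t(3,4), of \<omega>] obtain xs n3 s3 where
    3: "greedy S 0 xs" "exec \<omega> greedy_code s2 n3 s3"
    "n3 \<le> Suc (length xs) * (Suc h * greedy_rate)" "emitted s3 = xs" "same_store s2 s3"
    using S s2(2) q2 em2 t(5) by auto
  have "exec \<omega> request_prog s
      (bcost (ILess (INat 0) (IReg ''root'')) + (rcost (RNat 0) + 1 + (n2 + n3 + 1) + 1) + 1) s3"
    unfolding request_prog_def
  proof (rule exec.CondTrue)
    show "bval s (ILess (INat 0) (IReg ''root''))" using False by simp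
    have "exec \<omega> (RSet ''q'' (RNat 0)) s (rcost (RNat 0) + 1) ?s1"
      unfolding eff.simps by (rule exec.RSet)
    then show "exec \<omega> (RSet ''q'' (RNat 0) ;; find_code ;; greedy_code) s
        (rcost (RNat 0) + 1 + (n2 + n3 + 1) + 1) s3"
      by (rule exec.Seq[OF _ exec.Seq[OF n2(1) 3(2)]])
  qed
  moreover have "bcost (ILess (INat 0) (IReg ''root'')) + (rcost (RNat 0) + 1 + (n2 + n3 + 1) + 1) + 1
      \<le> Suc (length xs) * (Suc h * request_rate)"
  proof -
    have "n2 + 20 \<le> Suc h * (find_rate + 20)" using n2(2) by (simp add: algebra_simps)
    also have "\<dots> \<le> Suc (length xs) * (Suc h * (find_rate + 20))" by simp
    finally have "n2 + 20 + n3 \<le> Suc (length xs) * (Suc h * (find_rate + 20) + Suc h * greedy_rate)"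
      using 3(3) by (simp only: distrib_left)
    also have "Suc h * (find_rate + 20) + Suc h * greedy_rate = Suc h * request_rate"
      by (simp add: request_rate_def algebra_simps)
    finally show ?thesis by simp
  qed
  moreover have "stores s3 S h"
    using st same_store_trans[OF st2 3(5)] by (simp only: stores_same_store)
  ultimately show ?thesis using 3 by blast
qed


section \<open>The algorithm\<close>

definition greedy_algorithm :: algorithm where
  "greedy_algorithm =
     \<lparr>insert_code = insert_prog, delete_code = delete_prog, request_code = request_prog\<rparr>"

lemma greedy_algorithm_deterministic: "deterministic_algorithm greedy_algorithm"
  by (simp add: deterministic_algorithm_def greedy_algorithm_def insert_prog_def delete_prog_def
      request_prog_def alloc_leaf_def enter_root_def attach_leaf_def detach_leaf_def down_code_def
      down_body_def up_code_def up_body_def bal_code_def rotate_code_def mk_def find_code_def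
      greedy_code_def output_code_def enter_search_def search_code_def search_body_def
      search_leaf_def offer_def)

lemma current_snoc: "current (ops @ [p]) = apply_operation p (current ops)"
  by (simp add: current_def)

lemma valid_ops_snoc:
  "valid_ops N (ops @ [p]) \<longleftrightarrow> valid_ops N ops \<and> legal N (current ops) p"
  by (auto simp: valid_ops_def less_Suc_eq nth_append)

lemma admissible_current:
  "valid_ops N ops \<Longrightarrow> D \<in> current ops \<Longrightarrow> admissible N D"
proof (induction ops rule: rev_induct)
  case (snoc p ops)
  then show ?case by (cases p) (auto simp: valid_ops_snoc current_snoc)
qed (simp add: current_def)

lemma stores_call: "stores (call p s) S h = stores s S h"
  by (rule stores_same_store) (cases p; simp add: same_store_def)

definition op_rate :: nat where
  "op_rate = update_rate + request_rate"

lemma exec_update: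
  assumes S: "stores s S h" and p: "legal N S p" "p \<noteq> Request"
  shows "\<exists>n s' h'. exec \<omega> (code greedy_algorithm p) (call p s) n s' \<and> n \<le> Suc h * op_rate \<and>
    stores s' (apply_operation p S) h'"
proof -
  have "stores (call p s) S h" using S by (simp only: stores_call)
  have "Suc h * update_rate \<le> Suc h * op_rate" by (intro mult_left_mono) (simp_all add: op_rate_def)
  moreover have "runs \<omega> (code greedy_algorithm p) (call p s) (Suc h * update_rate)
      (\<lambda>s'. \<exists>h'. stores s' (apply_operation p S) h')"
  proof (cases p)
    case (Insert C)
    then have "arg (call p s) = C" by (simp add: arg_def)
    then show ?thesis using runs_insert_prog[OF \<open>stores (call p s) S h\<close>, of \<omega>] p Insert
      by (simp add: greedy_algorithm_def)
  next
    case (Delete C)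
    then have "arg (call p s) = C" by (simp add: arg_def)
    then show ?thesis using runs_delete_prog[OF \<open>stores (call p s) S h\<close>, of \<omega>] p Delete
      by (simp add: greedy_algorithm_def)
  qed (use p in simp)
  ultimately show ?thesis unfolding runs_def by (meson order_trans)
qed

lemma exec_request:
  assumes v: "valid_ops N ops" and S: "stores s (current ops) h"
  shows "\<exists>n s'. exec \<omega> (code greedy_algorithm Request) (call Request s) n s' \<and>
    greedy (current ops) 0 (emitted s') \<and>
    n \<le> Suc (length (emitted s')) * (Suc h * request_rate) \<and> stores s' (current ops) h"
proof -
  have "0 \<le> fst D \<and> fst D < snd D" if "D \<in> current ops" for D
    using admissible_current[OF v that] by (auto simp: admissible_def)
  moreover have "stores (call Request s) (current ops) h" using S by (simp only: stores_call)
  moreover have "emitted (call Request s) = []" by simp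
  ultimately show ?thesis
    using exec_request_prog[of "current ops" "call Request s" h \<omega>]
    by (simp add: greedy_algorithm_def) blast
qed

text \<open>The tape is arbitrary: the programs draw no coins, so every statement about them holds
  uniformly in \<open>\<omega>\<close>.\<close>

lemma reaches_stores:
  "valid_ops N ops \<Longrightarrow> \<exists>s h. reaches greedy_algorithm \<omega> N \<epsilon> ops s \<and> stores s (current ops) h"
proof (induction ops rule: rev_induct)
  case Nil
  have "stores (initial_state N \<epsilon>) (current []) 0"
    by (simp add: stores_def initial_state_def current_def)
  then show ?case using reaches.Start by blast
next
  case (snoc p ops)
  then obtain s h where s: "reaches greedy_algorithm \<omega> N \<epsilon> ops s" "stores s (current ops) h"
    by (auto simp: valid_ops_snoc)
  have "\<exists>n s' h'. exec \<omega> (code greedy_algorithm p) (call p s) n s' \<and>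
      stores s' (apply_operation p (current ops)) h'"
  proof (cases "p = Request")
    case True
    then show ?thesis
      using exec_request[OF _ s(2), of N \<omega>] snoc.prems unfolding valid_ops_snoc by auto
  next
    case False
    then show ?thesis
      using exec_update[OF s(2) _ False, of N \<omega>] snoc.prems unfolding valid_ops_snoc by blast
  qed
  then show ?case using reaches.Step[OF s(1)] by (metis current_snoc)
qed

section \<open>From tree height to logarithmic bounds\<close>

lemma lg_ge_1: "1 \<le> lg x"
  by (simp add: lg_def)

lemma height_le_lg: "2 ^ h \<le> max 1 (n\<^sup>2) \<Longrightarrow> real h \<le> 2 * lg (real n)"
proof (cases "n = 0")
  case False
  assume "2 ^ h \<le> max 1 (n\<^sup>2)"
  then have "2 ^ h \<le> n\<^sup>2" using False by (simp add: max_def split: if_splits)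
  then have "(2::real) ^ h \<le> real n ^ 2" by (metis of_nat_le_iff of_nat_numeral of_nat_power)
  then have "log 2 (2 ^ h) \<le> log 2 (real n ^ 2)" using False by (subst log_le_cancel_iff) auto
  then have "real h \<le> 2 * log 2 (real n)" using False by (simp add: log_nat_power)
  then show ?thesis by (simp add: lg_def)
next
  case True
  assume "2 ^ h \<le> max 1 (n\<^sup>2)"
  then have "2 ^ h \<le> (1 :: nat)" using True by simp
  then have "h < 1" by (rule less_le_trans[OF less_exp])
  then show ?thesis using lg_ge_1[of "real n"] by simp
qed

text \<open>Meant for \<open>m\<close> intervals before and \<open>n\<close> after an update, as a
  deletion lowers the count by one. For positive \<open>n\<close>, doubling the argument adds one to
  the logarithm, and \<open>lg\<close> is at least 1.\<close>

lemma lg_pred: "m \<le> Suc n \<Longrightarrow> lg (real m) \<le> 2 * lg (real n)"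
proof (cases "n = 0 \<or> m = 0")
  case False
  assume "m \<le> Suc n"
  then have "real m \<le> 2 * real n" using False by linarith
  then have "log 2 (real m) \<le> log 2 (2 * real n)" using False by (subst log_le_cancel_iff) auto
  also have "\<dots> = 1 + log 2 (real n)" using False by (simp add: log_mult)
  finally show ?thesis by (simp add: lg_def max_def)
next
  case True
  assume "m \<le> Suc n"
  then have "m = 0 \<or> m = 1" using True by auto
  then show ?thesis using lg_ge_1[of "real n"] by (auto simp: lg_def log_def)
qed

lemma update_time:
  "update_time_bound greedy_algorithm N \<epsilon> (\<lambda>n. 5 * real op_rate * lg (real n))"
  unfolding update_time_bound_def
proof (intro allI impI)
  fix \<omega> ops p
  assume a: "valid_ops N (ops @ [p]) \<and> p \<noteq> Request"
  then obtain s h where s: "reaches greedy_algorithm \<omega> N \<epsilon> ops s" "stores s (current ops) h"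
    using reaches_stores unfolding valid_ops_snoc by blast
  obtain n s' where n: "exec \<omega> (code greedy_algorithm p) (call p s) n s'" "n \<le> Suc h * op_rate"
    using exec_update[OF s(2), of N p \<omega>] a by (auto simp: valid_ops_snoc)
  let ?m = "card (current (ops @ [p]))"
  have "card (current ops) \<le> Suc ?m"
    using stores_finite[OF s(2)] by (cases p) (auto simp: current_snoc card_insert_if card_Diff_singleton_if)
  \<comment> \<open>A factor 2 comes from the squared leaf bound and another from passing to the
    count after the update; \<open>Suc h\<close> then gives 5.\<close>
  then have "real h \<le> 4 * lg (real ?m)"
    using height_le_lg[OF stores_height[OF s(2)]] lg_pred by fastforce
  then have "real (Suc h) \<le> 5 * lg (real ?m)" using lg_ge_1[of "real ?m"] by simp
  then have "real (Suc h) * real op_rate \<le> 5 * lg (real ?m) * real op_rate"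
    by (rule mult_right_mono) simp
  moreover have "real n \<le> real (Suc h) * real op_rate"
    using n(2) by (metis of_nat_le_iff of_nat_mult)
  ultimately show "\<exists>t. op_time greedy_algorithm \<omega> N \<epsilon> ops p t \<and> real t \<le> 5 * real op_rate * lg (real ?m)"
    using s(1) n(1) unfolding op_time_def by (intro exI[of _ n]) (auto simp: mult_ac)
qed

lemma answers_greedy:
  assumes v: "valid_ops N ops"
  shows "\<exists>n I. answers greedy_algorithm \<omega> N \<epsilon> ops n I \<and>
    real n \<le> 6 * real op_rate * real (max 1 (card I)) * lg (real (card (current ops))) \<and>
    I \<subseteq> current ops \<and> independent_intervals I \<and> opt_size (current ops) \<le> card I"
proof -
  let ?S = "current ops"
  obtain s h where s: "reaches greedy_algorithm \<omega> N \<epsilon> ops s" "stores s ?S h"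
    using reaches_stores[OF v] by blast
  obtain n s' where n: "exec \<omega> (code greedy_algorithm Request) (call Request s) n s'"
    "greedy ?S 0 (emitted s')" "n \<le> Suc (length (emitted s')) * (Suc h * request_rate)"
    using exec_request[OF v s(2)] by blast
  let ?I = "set (emitted s')"
  have S: "{D \<in> ?S. 0 \<le> fst D} = ?S" "\<And>D. D \<in> ?S \<Longrightarrow> fst D < snd D"
    using admissible_current[OF v] by (auto simp: admissible_def) fastforce
  have I: "?I \<subseteq> ?S" "distinct (emitted s')" "independent_intervals ?I"
    using greedy_independent[OF n(2) S(2)] by auto
  have card: "card ?I = length (emitted s')" using I(2) by (rule distinct_card)
  have fin: "finite ?S" using s(2) by (rule stores_finite)
  have "opt_size ?S \<le> card ?I"
    unfolding opt_size_def
  proof (rule Max.boundedI)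
    show "finite (card ` {I. I \<subseteq> ?S \<and> independent_intervals I})" using fin by simp
    show "card ` {I. I \<subseteq> ?S \<and> independent_intervals I} \<noteq> {}"
      using I by blast
  next
    fix k assume "k \<in> card ` {I. I \<subseteq> ?S \<and> independent_intervals I}"
    then obtain J where J: "J \<subseteq> ?S" "independent_intervals J" "k = card J" by blast
    then show "k \<le> card ?I"
      using greedy_optimal[OF n(2), of J] S(1) finite_subset[OF J(1) fin] card by simp
  qed
  moreover have "answers greedy_algorithm \<omega> N \<epsilon> ops n ?I"
    unfolding answers_def using s(1) n(1) I(2) by (auto simp: greedy_algorithm_def)
  moreover have "real n \<le> 6 * real op_rate * real (max 1 (card ?I)) * lg (real (card ?S))"
  proof -
    \<comment> \<open>The constant 6 is this 3 times the 2 lost in passing from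
      \<open>Suc (card I)\<close> to \<open>max 1 (card I)\<close>.\<close>
    have "real (Suc h) \<le> 3 * lg (real (card ?S))"
      using height_le_lg[OF stores_height[OF s(2)]] lg_ge_1[of "real (card ?S)"] by simp
    moreover have "real (Suc (card ?I)) \<le> 2 * real (max 1 (card ?I))" by (simp add: max_def)
    moreover have "real request_rate \<le> real op_rate" by (simp add: op_rate_def)
    ultimately have "real (Suc (card ?I)) * (real (Suc h) * real request_rate)
        \<le> 2 * real (max 1 (card ?I)) * (3 * lg (real (card ?S)) * real op_rate)"
      using lg_ge_1[of "real (card ?S)"] by (intro mult_mono) auto
    moreover have "real n \<le> real (Suc (card ?I)) * (real (Suc h) * real request_rate)"
      using n(3) card by (metis of_nat_le_iff of_nat_mult)
    ultimately show ?thesis by (simp add: mult_ac)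
  qed
  ultimately show ?thesis using I by blast
qed

lemma maintains_greedy:
  assumes "valid_ops N ops" "0 < \<epsilon>"
  shows "maintains greedy_algorithm \<omega> N \<epsilon> (1 + \<epsilon>) ops"
proof -
  obtain n I where I: "answers greedy_algorithm \<omega> N \<epsilon> ops n I" "I \<subseteq> current ops"
    "independent_intervals I" "opt_size (current ops) \<le> card I"
    using answers_greedy[OF assms(1)] by blast
  have "real (opt_size (current ops)) \<le> 1 * real (card I)" using I(4) by simp
  also have "\<dots> \<le> (1 + \<epsilon>) * real (card I)" using assms(2) by (intro mult_right_mono) auto
  finally show ?thesis using I unfolding maintains_def approximate_solution_def by blast
qed

lemma update_time_bound_mono:
  "update_time_bound A N \<epsilon> B \<Longrightarrow> (\<And>n. B n \<le> B' n) \<Longrightarrow> update_time_bound A N \<epsilon> B'"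
  unfolding update_time_bound_def by (meson order_trans)

lemma request_time:
  "request_time_bound greedy_algorithm N \<epsilon>
    (\<lambda>n m. 6 * real op_rate * real (max 1 m) * (lg (real n) * lg N) ^ 1)"
  unfolding request_time_bound_def
proof (intro allI impI)
  fix \<omega> ops
  assume "valid_ops N ops"
  then obtain n I where n: "answers greedy_algorithm \<omega> N \<epsilon> ops n I"
    "real n \<le> 6 * real op_rate * real (max 1 (card I)) * lg (real (card (current ops)))"
    using answers_greedy by blast
  have "lg (real (card (current ops))) \<le> (lg (real (card (current ops))) * lg N) ^ 1"
    using lg_ge_1[of N] lg_ge_1[of "real (card (current ops))"] by simp
  then have "6 * real op_rate * real (max 1 (card I)) * lg (real (card (current ops)))
      \<le> 6 * real op_rate * real (max 1 (card I)) * (lg (real (card (current ops))) * lg N) ^ 1"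
    by (intro mult_left_mono) auto
  then show "\<exists>t I. answers greedy_algorithm \<omega> N \<epsilon> ops t I \<and>
      real t \<le> 6 * real op_rate * real (max 1 (card I)) * (lg (real (card (current ops))) * lg N) ^ 1"
    using n by (meson order_trans)
qed

text \<open>From \<open>1 / \<epsilon> = 2 ^ j\<close> follows
  \<open>1 \<le> 1 / \<epsilon>\<close>, so the factors added on the right are at least 1. This lets
  one \<open>K\<close> serve both as the leading factor and in the exponent.\<close>

lemma deterministic_bound:
  assumes "\<epsilon> > 0" "1 / \<epsilon> = 2 ^ j" "0 \<le> K"
  shows "K * lg (real n) \<le> K * (1 / \<epsilon>) powr (K * (1 / \<epsilon>)) * (1 / \<epsilon> * lg (real n) * lg N) ^ 2"
proof -
  have e: "1 \<le> 1 / \<epsilon>" unfolding assms(2) by simp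
  have l: "1 \<le> lg (real n)" "1 \<le> lg N" by (rule lg_ge_1)+
  have powr: "1 \<le> (1 / \<epsilon>) powr (K * (1 / \<epsilon>))" using e assms(1,3) by (intro ge_one_powr_ge_zero) auto
  have "lg (real n) \<le> (1 / \<epsilon> * lg (real n) * lg N) ^ 2"
  proof -
    have "1 * lg (real n) * 1 \<le> 1 / \<epsilon> * lg (real n) * lg N"
      using e l assms(1) by (intro mult_mono) auto
    then have le: "lg (real n) \<le> 1 / \<epsilon> * lg (real n) * lg N" by simp
    also have "\<dots> \<le> (1 / \<epsilon> * lg (real n) * lg N) ^ 2"
      using self_le_power[OF order_trans[OF l(1) le], of 2] by simp
    finally show ?thesis .
  qed
  then have "1 * lg (real n) \<le> (1 / \<epsilon>) powr (K * (1 / \<epsilon>)) * (1 / \<epsilon> * lg (real n) * lg N) ^ 2"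
    by (rule mult_mono[OF powr]) (use powr l in linarith)+
  then have "K * (1 * lg (real n)) \<le> K * ((1 / \<epsilon>) powr (K * (1 / \<epsilon>)) * (1 / \<epsilon> * lg (real n) * lg N) ^ 2)"
    using assms(3) by (rule mult_left_mono)
  then show ?thesis by (simp add: mult.assoc)
qed

lemma randomized_bound:
  assumes "\<epsilon> > 0" "1 / \<epsilon> = 2 ^ j" "0 \<le> K"
  shows "K * lg (real n) \<le> K * (1 / \<epsilon> ^ 2 * lg N ^ 3 * lg (real n) ^ 2)"
proof (rule mult_left_mono[OF _ assms(3)])
  have e: "1 \<le> 1 / \<epsilon>" unfolding assms(2) by simp
  have l: "1 \<le> lg (real n)" "1 \<le> lg N" by (rule lg_ge_1)+
  have "1 \<le> 1 / \<epsilon> ^ 2" using one_le_power[OF e, of 2] by (simp add: power_one_over)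
  moreover have "1 \<le> lg N ^ 3" using l(2) by (rule one_le_power)
  moreover have "lg (real n) \<le> lg (real n) ^ 2" using self_le_power[OF l(1), of 2] by simp
  ultimately have "1 * 1 * lg (real n) \<le> 1 / \<epsilon> ^ 2 * lg N ^ 3 * lg (real n) ^ 2"
    using l assms(1) by (intro mult_mono) auto
  then show "lg (real n) \<le> 1 / \<epsilon> ^ 2 * lg N ^ 3 * lg (real n) ^ 2" by simp
qed

lemma prob_space_coin_tape: "prob_space coin_tape"
  unfolding coin_tape_def by (intro prob_space_PiM prob_space_measure_pmf)

theorem theorem15:
  shows
    "(\<exists>(A :: algorithm) (K :: real) (Q :: real \<Rightarrow> real) (d :: nat).
        deterministic_algorithm A \<and>
        (\<forall>(N :: real) (\<epsilon> :: real). N \<ge> 1 \<and> \<epsilon> > 0 \<and> (\<exists>j :: nat. 1 / \<epsilon> = 2 ^ j) \<longrightarrow>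
           update_time_bound A N \<epsilon>
             (\<lambda>n. K * (1 / \<epsilon>) powr (K * (1 / \<epsilon>)) * (1 / \<epsilon> * lg (real n) * lg N) ^ 2) \<and>
           request_time_bound A N \<epsilon>
             (\<lambda>n m. Q \<epsilon> * real (max 1 m) * (lg (real n) * lg N) ^ d) \<and>
           (\<forall>\<omega> ops. valid_ops N ops \<longrightarrow> maintains A \<omega> N \<epsilon> (1 + \<epsilon>) ops)))
     \<and>
     (\<exists>(A :: algorithm) (K :: real) (Q :: real \<Rightarrow> real) (d :: nat) (c :: real).
        randomized_algorithm A \<and> c > 0 \<and>
        (\<forall>(N :: real) (\<epsilon> :: real). N \<ge> 1 \<and> \<epsilon> > 0 \<and> (\<exists>j :: nat. 1 / \<epsilon> = 2 ^ j) \<longrightarrow>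
           update_time_bound A N \<epsilon>
             (\<lambda>n. K * (1 / \<epsilon> ^ 2 * lg N ^ 3 * lg (real n) ^ 2)) \<and>
           request_time_bound A N \<epsilon>
             (\<lambda>n m. Q \<epsilon> * real (max 1 m) * (lg (real n) * lg N) ^ d) \<and>
           (\<forall>ops. valid_ops N ops \<longrightarrow>
              {\<omega> \<in> space coin_tape. maintains A \<omega> N \<epsilon> (1 + \<epsilon>) ops} \<in> sets coin_tape \<and>
              measure coin_tape {\<omega> \<in> space coin_tape. maintains A \<omega> N \<epsilon> (1 + \<epsilon>) ops}
                \<ge> 1 - (1 / N) powr c)))"
proof (intro conjI)
  let ?K = "5 * real op_rate" and ?Q = "\<lambda>_ :: real. 6 * real op_rate"
  show "\<exists>(A :: algorithm) (K :: real) (Q :: real \<Rightarrow> real) (d :: nat).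
        deterministic_algorithm A \<and>
        (\<forall>(N :: real) (\<epsilon> :: real). N \<ge> 1 \<and> \<epsilon> > 0 \<and> (\<exists>j :: nat. 1 / \<epsilon> = 2 ^ j) \<longrightarrow>
           update_time_bound A N \<epsilon>
             (\<lambda>n. K * (1 / \<epsilon>) powr (K * (1 / \<epsilon>)) * (1 / \<epsilon> * lg (real n) * lg N) ^ 2) \<and>
           request_time_bound A N \<epsilon>
             (\<lambda>n m. Q \<epsilon> * real (max 1 m) * (lg (real n) * lg N) ^ d) \<and>
           (\<forall>\<omega> ops. valid_ops N ops \<longrightarrow> maintains A \<omega> N \<epsilon> (1 + \<epsilon>) ops))"
  proof (intro exI[of _ greedy_algorithm] exI[of _ ?K] exI[of _ ?Q] exI[of _ 1] conjI allI impI)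
    fix N \<epsilon> :: real
    assume "N \<ge> 1 \<and> \<epsilon> > 0 \<and> (\<exists>j :: nat. 1 / \<epsilon> = 2 ^ j)"
    then show "update_time_bound greedy_algorithm N \<epsilon>
        (\<lambda>n. ?K * (1 / \<epsilon>) powr (?K * (1 / \<epsilon>)) * (1 / \<epsilon> * lg (real n) * lg N) ^ 2)"
      by (elim conjE exE) (rule update_time_bound_mono[OF update_time], rule deterministic_bound; simp)
  qed (use greedy_algorithm_deterministic request_time maintains_greedy in blast)+
  show "\<exists>(A :: algorithm) (K :: real) (Q :: real \<Rightarrow> real) (d :: nat) (c :: real).
        randomized_algorithm A \<and> c > 0 \<and>
        (\<forall>(N :: real) (\<epsilon> :: real). N \<ge> 1 \<and> \<epsilon> > 0 \<and> (\<exists>j :: nat. 1 / \<epsilon> = 2 ^ j) \<longrightarrow>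
           update_time_bound A N \<epsilon>
             (\<lambda>n. K * (1 / \<epsilon> ^ 2 * lg N ^ 3 * lg (real n) ^ 2)) \<and>
           request_time_bound A N \<epsilon>
             (\<lambda>n m. Q \<epsilon> * real (max 1 m) * (lg (real n) * lg N) ^ d) \<and>
           (\<forall>ops. valid_ops N ops \<longrightarrow>
              {\<omega> \<in> space coin_tape. maintains A \<omega> N \<epsilon> (1 + \<epsilon>) ops} \<in> sets coin_tape \<and>
              measure coin_tape {\<omega> \<in> space coin_tape. maintains A \<omega> N \<epsilon> (1 + \<epsilon>) ops}
                \<ge> 1 - (1 / N) powr c))"
  \<comment> \<open>The last two witnesses are \<open>d = 1\<close> and
    \<open>c = 1\<close>.\<close>
  proof (rule exI[of _ greedy_algorithm], rule exI[of _ ?K], rule exI[of _ ?Q], rule exI[of _ 1],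
      rule exI[of _ 1], intro conjI allI impI)
    show "randomized_algorithm greedy_algorithm"
      using greedy_algorithm_deterministic
      by (simp add: randomized_algorithm_def deterministic_algorithm_def)
  next
    fix N \<epsilon> :: real
    assume "N \<ge> 1 \<and> \<epsilon> > 0 \<and> (\<exists>j :: nat. 1 / \<epsilon> = 2 ^ j)"
    then show "update_time_bound greedy_algorithm N \<epsilon>
        (\<lambda>n. ?K * (1 / \<epsilon> ^ 2 * lg N ^ 3 * lg (real n) ^ 2))"
      by (elim conjE exE) (rule update_time_bound_mono[OF update_time], rule randomized_bound; simp)
  next
    fix N \<epsilon> :: real and ops
    assume "N \<ge> 1 \<and> \<epsilon> > 0 \<and> (\<exists>j :: nat. 1 / \<epsilon> = 2 ^ j)" and "valid_ops N ops"
    \<comment> \<open>Every tape succeeds, so the event is the whole space: it is measurable and has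
      probability 1.\<close>
    then have *: "{\<omega> \<in> space coin_tape. maintains greedy_algorithm \<omega> N \<epsilon> (1 + \<epsilon>) ops} = space coin_tape"
      using maintains_greedy by blast
    show "{\<omega> \<in> space coin_tape. maintains greedy_algorithm \<omega> N \<epsilon> (1 + \<epsilon>) ops} \<in> sets coin_tape"
      unfolding * by simp
    show "measure coin_tape {\<omega> \<in> space coin_tape. maintains greedy_algorithm \<omega> N \<epsilon> (1 + \<epsilon>) ops}
        \<ge> 1 - (1 / N) powr 1"
      unfolding * prob_space.prob_space[OF prob_space_coin_tape] by simp
  qed (use request_time in simp)+
qed

end
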